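(* Let $\lambda$ be a partition of $n$ and let $t$ be a $\lambda$-tableau. Let $H(t)$ be the subgroup of the row-stabilising group of $t$ which permutes, as blocks for its action, the entries of columns of equal length in $t$. Let $F$ be a field of prime characteristic $p$. If the Specht module $S^\lambda$, defined over $F$, is indecomposable, then it has a vertex containing a Sylow $p$-subgroup of $H(t)$.
   Context: Permutations act on the right. For a partition $\lambda$ of $n$, a $\lambda$-tableau is a filling of the boxes of the Young diagram of $\lambda$ with the numbers $1,\ldots,n$, all entries distinct. The row-stabilising group of $t$ is the subgroup of the symmetric group $S_n$ of permutations fixing setwise each row of $t$. Explicitly, $H(t)$ consists of those $h \in S_n$ that fix setwise every row of $t$ and map the set of entries of each column of $t$ onto the set of entries of some column of $t$ (necessarily of the same length). For example, if $\lambda=(8,4,1)$ and $t$ has rows $1,\ldots,8$; $9,\ldots,12$; $13$ (in increasing order), then $H(t)$ is generated by $(2,3,4)(10,11,12)$, $(2,3)(10,11)$, $(5,6,7,8)$, $(5,6)$. Specht modules: the tabloid $\mathbf{t}$ of a tableau $t$ is the equivalence class of $t$ under reordering the entries within rows; $S_n$ acts on tabloids by acting on entries, and $M^\lambda$ is the corresponding permutation module over the ground ring. Let $C(t)\le S_n$ be the group of permutations fixing setwise each column of $t$. The polytabloid of $t$ is $e_t = \sum_{g \in C(t)} \operatorname{sgn}(g)\, \mathbf{t} g \in M^\lambda$, and the Specht module $S^\lambda$ is the submodule of $M^\lambda$ spanned by all $e_t$, $t$ a $\lambda$-tableau. Vertices: for a finite group $G$ and an indecomposable $FG$-module $M$,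 a subgroup $Q\le G$ is a vertex of $M$ if there is an indecomposable $FQ$-module $N$ such that $M$ is a direct summand of the induced module $N\uparrow_Q^G$, and $Q$ is minimal with this property. Vertices are $p$-groups and form a single conjugacy class of subgroups of $G$. *)

theory Defs
  imports
    Complex_Main
    "HOL-Algebra.Sym_Groups"
    "HOL-Computational_Algebra.Primes"
    "HOL-Library.Function_Algebras"
begin

section \<open>Modules for a group over a field\<close>

record ('f, 'g, 'v) gmod =
  scl :: "'f \<Rightarrow> 'v \<Rightarrow> 'v"
  vecs :: "'v set"
  act :: "'g \<Rightarrow> 'v \<Rightarrow> 'v"

text \<open>
  An $FG$-module is a subspace of an $F$-vector space on which $G$ acts linearly. As usual in
  this theory, all modules are finitely generated, that is, finite-dimensional over $F$.
\<close>

locale gmodule = group G + vector_space "scl M"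
  for G :: "('g, 'x) monoid_scheme" (structure)
    and M :: "('f::field, 'g, 'v::ab_group_add) gmod" +
  assumes finitely_generated: "\<exists>B. finite B \<and> vecs M = span B"
    and act_closed: "\<lbrakk>g \<in> carrier G; v \<in> vecs M\<rbrakk> \<Longrightarrow> act M g v \<in> vecs M"
    and act_add: "\<lbrakk>g \<in> carrier G; v \<in> vecs M; w \<in> vecs M\<rbrakk> \<Longrightarrow>
      act M g (v + w) = act M g v + act M g w"
    and act_scl: "\<lbrakk>g \<in> carrier G; v \<in> vecs M\<rbrakk> \<Longrightarrow> act M g (scl M c v) = scl M c (act M g v)"
    and act_one: "v \<in> vecs M \<Longrightarrow> act M \<one> v = v"
    and act_mult: "\<lbrakk>g \<in> carrier G; h \<in> carrier G; v \<in> vecs M\<rbrakk> \<Longrightarrow>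
      act M (g \<otimes> h) v = act M g (act M h v)"

definition gsubmodule ::
  "('g, 'x) monoid_scheme \<Rightarrow> ('f::field, 'g, 'v::ab_group_add) gmod \<Rightarrow> 'v set \<Rightarrow> bool"
  where "gsubmodule G M W \<longleftrightarrow>
    module.subspace (scl M) W \<and> W \<subseteq> vecs M \<and> (\<forall>g\<in>carrier G. \<forall>w\<in>W. act M g w \<in> W)"

definition direct_decomposition ::
  "('g, 'x) monoid_scheme \<Rightarrow> ('f::field, 'g, 'v::ab_group_add) gmod \<Rightarrow> 'v set \<Rightarrow> 'v set \<Rightarrow> bool"
  where "direct_decomposition G M A B \<longleftrightarrow>
    gsubmodule G M A \<and> gsubmodule G M B \<and>
    A \<inter> B = {0} \<and> vecs M = {a + b | a b. a \<in> A \<and> b \<in> B}"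

definition indecomposable ::
  "('g, 'x) monoid_scheme \<Rightarrow> ('f::field, 'g, 'v::ab_group_add) gmod \<Rightarrow> bool"
  where "indecomposable G M \<longleftrightarrow>
    gmodule G M \<and> vecs M \<noteq> {0} \<and>
    (\<forall>A B. direct_decomposition G M A B \<longrightarrow> A = {0} \<or> B = {0})"

definition gmod_isomorphic ::
  "('g, 'x) monoid_scheme \<Rightarrow> ('f::field, 'g, 'v::ab_group_add) gmod \<Rightarrow>
    ('f, 'g, 'w::ab_group_add) gmod \<Rightarrow> bool"
  where "gmod_isomorphic G M N \<longleftrightarrow>
    (\<exists>\<phi>. bij_betw \<phi> (vecs M) (vecs N) \<and>
      (\<forall>v\<in>vecs M. \<forall>w\<in>vecs M. \<phi> (v + w) = \<phi> v + \<phi> w) \<and>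
      (\<forall>c. \<forall>v\<in>vecs M. \<phi> (scl M c v) = scl N c (\<phi> v)) \<and>
      (\<forall>g\<in>carrier G. \<forall>v\<in>vecs M. \<phi> (act M g v) = act N g (\<phi> v)))"

definition direct_summand ::
  "('g, 'x) monoid_scheme \<Rightarrow> ('f::field, 'g, 'v::ab_group_add) gmod \<Rightarrow>
    ('f, 'g, 'w::ab_group_add) gmod \<Rightarrow> bool"
  where "direct_summand G M X \<longleftrightarrow>
    (\<exists>A B. direct_decomposition G X A B \<and> gmod_isomorphic G M (X\<lparr>vecs := A\<rparr>))"

text \<open>
  The induced module $FG \otimes_{FQ} N$ ($G$ finite), realised on functions: $g \otimes v$ is the
  function supported on the coset $gQ$ with value $q^{-1} v$ at $gq$ for $q \in Q$.
  Thus $x (g \otimes v) = xg \otimes v$ is translation of functions.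
\<close>

definition induced ::
  "('g, 'x) monoid_scheme \<Rightarrow> 'g set \<Rightarrow> ('f::field, 'g, 'v::ab_group_add) gmod \<Rightarrow>
    ('f, 'g, 'g \<Rightarrow> 'v) gmod"
  where "induced G Q N = \<lparr>
    scl = (\<lambda>c f g. scl N c (f g)),
    vecs = {f. (\<forall>g\<in>carrier G. f g \<in> vecs N) \<and> (\<forall>g. g \<notin> carrier G \<longrightarrow> f g = 0) \<and>
      (\<forall>g\<in>carrier G. \<forall>q\<in>Q. f (g \<otimes>\<^bsub>G\<^esub> q) = act N (inv\<^bsub>G\<^esub> q) (f g))},
    act = (\<lambda>x f g. if g \<in> carrier G then f (inv\<^bsub>G\<^esub> x \<otimes>\<^bsub>G\<^esub> g) else 0) \<rparr>"


section \<open>Vertices and Sylow subgroups\<close>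

text \<open>
  Fixing the type of the vectors of \<open>N\<close> loses nothing: every finite-dimensional module over $F$ is
  isomorphic to one whose vectors are the sequences supported on the first $d$ positions.
\<close>

definition summand_of_induced ::
  "('g, 'x) monoid_scheme \<Rightarrow> ('f::field, 'g, 'v::ab_group_add) gmod \<Rightarrow> 'g set \<Rightarrow> bool"
  where "summand_of_induced G M Q \<longleftrightarrow>
    subgroup Q G \<and>
    (\<exists>N :: ('f, 'g, nat \<Rightarrow> 'f) gmod.
      indecomposable (G\<lparr>carrier := Q\<rparr>) N \<and> direct_summand G M (induced G Q N))"

definition is_vertex ::
  "('g, 'x) monoid_scheme \<Rightarrow> ('f::field, 'g, 'v::ab_group_add) gmod \<Rightarrow> 'g set \<Rightarrow> bool"
  where "is_vertex G M Q \<longleftrightarrow>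
    summand_of_induced G M Q \<and> (\<forall>R. summand_of_induced G M R \<and> R \<subseteq> Q \<longrightarrow> R = Q)"

definition sylow_subgroup :: "nat \<Rightarrow> ('g, 'x) monoid_scheme \<Rightarrow> 'g set \<Rightarrow> bool"
  where "sylow_subgroup p G P \<longleftrightarrow> subgroup P G \<and> card P = p ^ multiplicity p (order G)"


section \<open>Tableaux and Specht modules\<close>

definition partition_of :: "nat \<Rightarrow> nat list \<Rightarrow> bool"
  where "partition_of n l \<longleftrightarrow> sorted_wrt (\<ge>) l \<and> 0 \<notin> set l \<and> sum_list l = n"

definition young_diagram :: "nat list \<Rightarrow> (nat \<times> nat) set"
  where "young_diagram l = {(i, j). i < length l \<and> j < l ! i}"

text \<open>
  Values of a tableau outside the Young diagram play no role: they are arbitrary in every element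
  of a tabloid.
\<close>

definition tableau :: "nat list \<Rightarrow> (nat \<times> nat \<Rightarrow> nat) \<Rightarrow> bool"
  where "tableau l t \<longleftrightarrow> bij_betw t (young_diagram l) {1..sum_list l}"

definition row_entries :: "nat list \<Rightarrow> (nat \<times> nat \<Rightarrow> nat) \<Rightarrow> nat \<Rightarrow> nat set"
  where "row_entries l t i = {t (i, j) | j. (i, j) \<in> young_diagram l}"

definition column_entries :: "nat list \<Rightarrow> (nat \<times> nat \<Rightarrow> nat) \<Rightarrow> nat \<Rightarrow> nat set"
  where "column_entries l t j = {t (i, j) | i. (i, j) \<in> young_diagram l}"

definition row_stabiliser :: "nat list \<Rightarrow> (nat \<times> nat \<Rightarrow> nat) \<Rightarrow> (nat \<Rightarrow> nat) set"
  where "row_stabiliser l t =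
    {g \<in> carrier (sym_group (sum_list l)). \<forall>i. g ` row_entries l t i = row_entries l t i}"

definition column_stabiliser :: "nat list \<Rightarrow> (nat \<times> nat \<Rightarrow> nat) \<Rightarrow> (nat \<Rightarrow> nat) set"
  where "column_stabiliser l t =
    {g \<in> carrier (sym_group (sum_list l)). \<forall>j. g ` column_entries l t j = column_entries l t j}"

definition column_permuting_group :: "nat list \<Rightarrow> (nat \<times> nat \<Rightarrow> nat) \<Rightarrow> (nat \<Rightarrow> nat) set"
  where "column_permuting_group l t =
    {h \<in> row_stabiliser l t. \<forall>j. \<exists>k. h ` column_entries l t j = column_entries l t k}"

type_synonym tabloid = "(nat \<times> nat \<Rightarrow> nat) set"

definition tabloid_of :: "nat list \<Rightarrow> (nat \<times> nat \<Rightarrow> nat) \<Rightarrow> tabloid"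
  where "tabloid_of l t = {s. tableau l s \<and> (\<forall>i. row_entries l s i = row_entries l t i)}"

text \<open>
  The product of \<^const>\<open>sym_group\<close> is composition of functions, so the action of permutations on
  entries is a left action; with the opposite product, the same maps form a right action.
\<close>

definition tabloid_act :: "(nat \<Rightarrow> nat) \<Rightarrow> tabloid \<Rightarrow> tabloid"
  where "tabloid_act g T = (\<lambda>s. g \<circ> s) ` T"

definition tabloid_vec :: "tabloid \<Rightarrow> tabloid \<Rightarrow> 'f::field"
  where "tabloid_vec T = (\<lambda>S. if S = T then 1 else 0)"

type_synonym 'f tabloid_module = "('f, nat \<Rightarrow> nat, tabloid \<Rightarrow> 'f) gmod"

definition permutation_module :: "nat list \<Rightarrow> 'f::field tabloid_module"
  where "permutation_module l = \<lparr>
    scl = (\<lambda>c v T. c * v T),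
    vecs = {v. \<forall>T. v T \<noteq> 0 \<longrightarrow> (\<exists>t. tableau l t \<and> T = tabloid_of l t)},
    act = (\<lambda>g v T. v (tabloid_act (inv' g) T)) \<rparr>"

definition polytabloid :: "nat list \<Rightarrow> (nat \<times> nat \<Rightarrow> nat) \<Rightarrow> tabloid \<Rightarrow> 'f::field"
  where "polytabloid l t =
    (\<Sum>g\<in>column_stabiliser l t.
      scl (permutation_module l) (of_int (sign g)) (tabloid_vec (tabloid_act g (tabloid_of l t))))"

definition specht_module :: "nat list \<Rightarrow> 'f::field tabloid_module"
  where "specht_module l = (permutation_module l)
    \<lparr>vecs := module.span (scl (permutation_module l :: 'f tabloid_module))
      {polytabloid l t | t. tableau l t}\<rparr>"

end

theory Submission
  imports Defs "HOL-Algebra.Group_Action" "HOL-Algebra.Sylow"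
begin

text \<open>
  Let $P$ be a Sylow $p$-subgroup of the group $H(t)$. The idea is that $P$ fixes the polytabloid
  $e_t$, and that $e_t$ is visible to a $P$-invariant linear functional: elements of $H(t)$ fix the
  tabloid of $t$, because they preserve its rows, and normalise the column stabiliser of $t$,
  because they permute its columns. Hence they fix $e_t$, and reading off the coefficient at the
  tabloid of $t$ is an $H(t)$-invariant functional. Its value at $e_t$ is $1$, since only the
  identity preserves both the rows and the columns of $t$.

  It remains to see that this forces $P$ into a vertex. In terms of modules, the vector and the
  functional make the trivial $P$-module a direct summand of the restriction of $S^\<lambda>$ to $P$, so
  that the Brauer quotient of $S^\<lambda>$ at $P$ is nonzero. What is needed from the theory of the Brauer
  quotient is short enough to be proved directly
  (\<open>fixed_vector_imp_subset_conjugate\<close>): if $M$ is a summand of a module induced from a subgroup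
  $Q$, extend the functional to the induced module by projecting onto the summand, and decompose
  the vector according to the left cosets $gQ$ on which its parts are supported. The values of the
  functional on these parts are constant on the orbits of $P$ on $G/Q$, and they sum to a nonzero
  element. In characteristic $p$, orbits of length divisible by $p$ contribute nothing
  (\<open>sum_invariant_eq_0\<close>), so that the $p$-group $P$ must fix some coset $gQ$; this says
  that $P$ lies in $gQg^{-1}$.

  A subgroup of least order among those from which $M$ is a summand of an induced module is a vertex,
  and so are all its conjugates (\<open>summand_of_induced_conjugate\<close>); one of these conjugates
  contains $P$. Such subgroups exist, because $M$ is induced from $G$ itself
  (\<open>summand_of_induced_carrier\<close>).
\<close>

section \<open>Subgroups, cosets and actions of $p$-groups\<close>

text \<open>
  Every orbit has $p$-power length by the orbit-stabiliser theorem, and length one is excluded, so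
  that the constant value on an orbit is added up a multiple of $p$ times.
\<close>

lemma (in group_action) sum_invariant_eq_0:
  fixes c :: "_ \<Rightarrow> 'f::field"
  assumes "finite E" and "order G = CHAR('f) ^ k" and p: "prime CHAR('f)"
    and inv: "\<And>g s. \<lbrakk>g \<in> carrier G; s \<in> E\<rbrakk> \<Longrightarrow> c (\<phi> g s) = c s"
    and no_fixed: "\<And>s. s \<in> E \<Longrightarrow> \<exists>g\<in>carrier G. \<phi> g s \<noteq> s"
  shows "(\<Sum>s\<in>E. c s) = 0"
proof -
  have "(\<Sum>s\<in>orb. c s) = 0" if orb_in: "orb \<in> orbits G E \<phi>" for orb
  proof -
    obtain s where s: "s \<in> E" and orb: "orb = orbit G \<phi> s"
      using orb_in unfolding orbits_def by blast
    have "card orb dvd CHAR('f) ^ k"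
      using orbit_stabilizer_theorem[OF s] assms(2) orb by (metis dvd_triv_left)
    then obtain j where j: "card orb = CHAR('f) ^ j"
      using divides_primepow_nat[OF p] by blast
    obtain g where g: "g \<in> carrier G" "\<phi> g s \<noteq> s"
      using no_fixed s by blast
    have "\<phi> g s \<in> orb" "s \<in> orb"
      using g orbit_refl[OF s] unfolding orb by (auto simp: orbit_def)
    then have "card orb \<noteq> 1"
      using g(2) by (metis card_1_singletonE singletonD)
    then have "CHAR('f) dvd card orb"
      using j by (cases j) auto
    then have "of_nat (card orb) = (0::'f)"
      by (simp add: of_nat_eq_0_iff_char_dvd)
    moreover have "(\<Sum>s'\<in>orb. c s') = (\<Sum>s'\<in>orb. c s)"
      using inv s unfolding orb orbit_def by (intro sum.cong) auto
    ultimately show ?thesis by simp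
  qed
  then have "(\<Sum>orb\<in>orbits G E \<phi>. \<Sum>s\<in>orb. c s) = 0"
    by (rule sum.neutral[OF ballI])
  then show ?thesis
    using disjoint_sum[OF assms(1)] by metis
qed

text \<open>
  The subgroup $gQg^{-1}$, given by a membership condition rather than as an image: to say that $P$
  is contained in it is then to say that $g^{-1}hg \<in> Q$ for all $h \<in> P$, that is, that $P$ fixes
  the coset $gQ$.
\<close>

definition conjugate_subgroup :: "('g, 'x) monoid_scheme \<Rightarrow> 'g \<Rightarrow> 'g set \<Rightarrow> 'g set"
  where "conjugate_subgroup G g Q = {x \<in> carrier G. inv\<^bsub>G\<^esub> g \<otimes>\<^bsub>G\<^esub> x \<otimes>\<^bsub>G\<^esub> g \<in> Q}"

lemma (in group) inverse_conjugate_conjugate: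
  assumes "g \<in> carrier G" "q \<in> carrier G"
  shows "inv g \<otimes> (g \<otimes> q \<otimes> inv g) \<otimes> g = q"
  using assms by (simp add: m_assoc) (simp flip: m_assoc)

lemma (in group) conjugate_inverse_conjugate:
  assumes "g \<in> carrier G" "q \<in> carrier G"
  shows "g \<otimes> (inv g \<otimes> q \<otimes> g) \<otimes> inv g = q"
  using inverse_conjugate_conjugate[of "inv g" q] assms by simp

lemma (in group) conjugate_mult:
  assumes "g \<in> carrier G" "x \<in> carrier G" "y \<in> carrier G"
  shows "inv g \<otimes> (x \<otimes> y) \<otimes> g = (inv g \<otimes> x \<otimes> g) \<otimes> (inv g \<otimes> y \<otimes> g)"
proof -
  have "g \<otimes> (inv g \<otimes> (y \<otimes> g)) = y \<otimes> g"
    using assms by (simp flip: m_assoc)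
  then show ?thesis using assms by (simp add: m_assoc)
qed

lemma (in group) conjugate_inv:
  assumes "g \<in> carrier G" "x \<in> carrier G"
  shows "inv g \<otimes> inv x \<otimes> g = inv (inv g \<otimes> x \<otimes> g)"
  using assms by (simp add: inv_mult_group m_assoc)

lemma (in group) subgroup_conjugate_subgroup:
  assumes Q: "subgroup Q G" and g: "g \<in> carrier G"
  shows "subgroup (conjugate_subgroup G g Q) G"
proof (rule subgroupI)
  have "\<one> \<in> conjugate_subgroup G g Q"
    using g subgroup.one_closed[OF Q] by (simp add: conjugate_subgroup_def)
  then show "conjugate_subgroup G g Q \<noteq> {}" by blast
qed (use assms in \<open>auto simp: conjugate_subgroup_def conjugate_mult
  conjugate_inv subgroup.m_closed subgroup.m_inv_closed\<close>)

lemma (in group) conjugate_subgroup_bij_betw: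
  assumes Q: "subgroup Q G" and g: "g \<in> carrier G"
  shows "bij_betw (\<lambda>x. inv g \<otimes> x \<otimes> g) (conjugate_subgroup G g Q) Q"
  by (rule bij_betw_byWitness[where f' = "\<lambda>q. g \<otimes> q \<otimes> inv g"])
    (use assms in \<open>auto simp: conjugate_subgroup_def inverse_conjugate_conjugate
      conjugate_inverse_conjugate subgroup.mem_carrier\<close>)

lemma (in group) card_conjugate_subgroup:
  assumes "subgroup Q G" "g \<in> carrier G"
  shows "card (conjugate_subgroup G g Q) = card Q"
  using conjugate_subgroup_bij_betw[OF assms] by (rule bij_betw_same_card)

text \<open>
  The group $P$ acts on $G/Q$ by left translation. The restriction of the maps to the set of cosets is
  what \<^const>\<open>BijGroup\<close> demands.
\<close>

lemma (in group) l_coset_action: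
  assumes Q: "subgroup Q G" and P: "subgroup P G"
  shows "group_action (G\<lparr>carrier := P\<rparr>) ((\<lambda>x. x <# Q) ` carrier G)
     (\<lambda>h. \<lambda>C\<in>(\<lambda>x. x <# Q) ` carrier G. h <# C)"
    (is "group_action _ ?E ?\<phi>")
proof -
  have QG: "Q \<subseteq> carrier G" using Q by (rule subgroup.subset)
  have mult: "h <# (x <# Q) = (h \<otimes> x) <# Q" if "h \<in> carrier G" "x \<in> carrier G" for h x
    using that QG by (simp add: lcos_m_assoc)
  have closed: "h <# C \<in> ?E" if "h \<in> carrier G" "C \<in> ?E" for h C
    using that mult by auto
  have comp: "g <# (h <# C) = (g \<otimes> h) <# C" if "g \<in> carrier G" "h \<in> carrier G" "C \<in> ?E" for g h C
    using that mult by (auto simp: m_assoc)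
  have one: "\<one> <# C = C" if "C \<in> ?E" for C
    using that mult by auto
  have bij: "?\<phi> h \<in> Bij ?E" if "h \<in> carrier G" for h
  proof -
    have "bij_betw (\<lambda>C. h <# C) ?E ?E"
      by (rule bij_betw_byWitness[where f' = "\<lambda>C. inv h <# C"])
        (use that in \<open>auto simp: comp one closed simp del: image_iff\<close>)
    then show ?thesis by (simp add: Bij_def bij_betw_restrict_eq)
  qed
  show ?thesis
  proof (intro group_action.intro group_hom.intro group_hom_axioms.intro homI)
    show "group (G\<lparr>carrier := P\<rparr>)" using P by (rule subgroup_imp_group)
    show "group (BijGroup ?E)" by (rule group_BijGroup)
    show "?\<phi> h \<in> carrier (BijGroup ?E)" if "h \<in> carrier (G\<lparr>carrier := P\<rparr>)" for h
      using bij that subgroup.mem_carrier[OF P] by (simp add: BijGroup_def)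
    show "?\<phi> (g \<otimes>\<^bsub>G\<lparr>carrier := P\<rparr>\<^esub> h) = ?\<phi> g \<otimes>\<^bsub>BijGroup ?E\<^esub> ?\<phi> h"
      if "g \<in> carrier (G\<lparr>carrier := P\<rparr>)" "h \<in> carrier (G\<lparr>carrier := P\<rparr>)" for g h
    proof -
      have "g \<in> carrier G" "h \<in> carrier G" using that subgroup.mem_carrier[OF P] by auto
      then show ?thesis
        using bij closed comp by (auto simp: BijGroup_def compose_def fun_eq_iff)
    qed
  qed
qed

text \<open>
  Multiplication by $a$ is injective on the finite set $H$, hence surjective, and reaches the identity.
\<close>

lemma (in group) finite_submonoid_imp_subgroup:
  assumes H: "H \<subseteq> carrier G" "finite H" "\<one> \<in> H"
    and closed: "\<And>a b. \<lbrakk>a \<in> H; b \<in> H\<rbrakk> \<Longrightarrow> a \<otimes> b \<in> H"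
  shows "subgroup H G"
proof (rule subgroupI)
  fix a assume a: "a \<in> H"
  have "inj_on ((\<otimes>) a) H"
    using H(1) a by (auto simp: inj_on_def subset_iff)
  moreover have "(\<otimes>) a ` H \<subseteq> H" using closed a by blast
  ultimately have "(\<otimes>) a ` H = H" using H(2) by (simp add: endo_inj_surj)
  then obtain b where b: "b \<in> H" "a \<otimes> b = \<one>" using H(3) by (metis imageE)
  then have bG: "b \<in> carrier G" using H(1) by blast
  have "inv b = a" using b(2) bG H(1) a by (intro inv_equality) auto
  then have "inv a = b" using bG by auto
  then show "inv a \<in> H" using b by simp
qed (use H closed in auto)

lemma (in group) sylow_subgroup_exists:
  assumes "finite (carrier G)" "prime p"
  shows "\<exists>P. sylow_subgroup p G P"
proof -
  obtain m where "order G = p ^ multiplicity p (order G) * m"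
    using multiplicity_dvd by (metis dvd_def)
  then show ?thesis
    using sylow_thm[OF assms(2) group_axioms _ assms(1)] by (auto simp: sylow_subgroup_def)
qed

section \<open>Isomorphisms and direct decompositions of modules\<close>

lemma (in gmodule) subspace_vecs: "subspace (vecs M)"
  using finitely_generated subspace_span by metis

lemma (in gmodule) act_zero:
  assumes "g \<in> carrier G"
  shows "act M g 0 = 0"
  using act_scl[OF assms subspace_0[OF subspace_vecs], of 0] by simp

text \<open>
  The condition on the map in \<^const>\<open>gmod_isomorphic\<close>, so that an explicit isomorphism can be
  composed, inverted and restricted.
\<close>

definition gmod_iso ::
  "('g, 'x) monoid_scheme \<Rightarrow> ('f::field, 'g, 'v::ab_group_add) gmod \<Rightarrow>
    ('f, 'g, 'w::ab_group_add) gmod \<Rightarrow> ('v \<Rightarrow> 'w) \<Rightarrow> bool"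
  where "gmod_iso G M N \<phi> \<longleftrightarrow>
    bij_betw \<phi> (vecs M) (vecs N) \<and>
      (\<forall>v\<in>vecs M. \<forall>w\<in>vecs M. \<phi> (v + w) = \<phi> v + \<phi> w) \<and>
      (\<forall>c. \<forall>v\<in>vecs M. \<phi> (scl M c v) = scl N c (\<phi> v)) \<and>
      (\<forall>g\<in>carrier G. \<forall>v\<in>vecs M. \<phi> (act M g v) = act N g (\<phi> v))"

lemma gmod_isomorphic_iff: "gmod_isomorphic G M N \<longleftrightarrow> (\<exists>\<phi>. gmod_iso G M N \<phi>)"
  unfolding gmod_isomorphic_def gmod_iso_def ..

lemma gmod_iso_trans:
  assumes "gmod_iso G M N \<phi>" "gmod_iso G N K \<psi>"
  shows "gmod_iso G M K (\<psi> \<circ> \<phi>)"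
proof -
  have "\<phi> v \<in> vecs N" if "v \<in> vecs M" for v
    using assms(1) that by (auto simp: gmod_iso_def dest: bij_betwE)
  then show ?thesis
    using assms by (auto simp: gmod_iso_def intro: bij_betw_trans)
qed

lemma gmod_iso_inv:
  assumes M: "gmodule G M" and \<phi>: "gmod_iso G M N \<phi>"
  shows "gmod_iso G N M (inv_into (vecs M) \<phi>)"
proof -
  interpret gmodule G M by fact
  let ?\<psi> = "inv_into (vecs M) \<phi>"
  have bij: "bij_betw \<phi> (vecs M) (vecs N)" using \<phi> by (simp add: gmod_iso_def)
  have r: "\<phi> (?\<psi> w) = w" "?\<psi> w \<in> vecs M" if "w \<in> vecs N" for w
    using bij that by (auto simp: bij_betw_inv_into_right bij_betw_def inv_into_into)
  have l: "?\<psi> (\<phi> v) = v" if "v \<in> vecs M" for v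
    using bij that by (rule bij_betw_inv_into_left)
  have "?\<psi> (v + w) = ?\<psi> v + ?\<psi> w" if "v \<in> vecs N" "w \<in> vecs N" for v w
    using \<phi> that r l[of "?\<psi> v + ?\<psi> w"] subspace_add[OF subspace_vecs]
    by (simp add: gmod_iso_def)
  moreover have "?\<psi> (scl N c v) = scl M c (?\<psi> v)" if "v \<in> vecs N" for c v
    using \<phi> that r l[of "scl M c (?\<psi> v)"] subspace_scale[OF subspace_vecs]
    by (simp add: gmod_iso_def)
  moreover have "?\<psi> (act N g v) = act M g (?\<psi> v)" if "v \<in> vecs N" "g \<in> carrier G" for g v
    using \<phi> that r l[of "act M g (?\<psi> v)"] act_closed
    by (simp add: gmod_iso_def)
  ultimately show ?thesis
    using bij_betw_inv_into[OF bij] by (simp add: gmod_iso_def)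
qed

lemma gmod_iso_restrict:
  assumes "gmod_iso G X Y \<phi>" "A \<subseteq> vecs X"
  shows "gmod_iso G (X\<lparr>vecs := A\<rparr>) (Y\<lparr>vecs := \<phi> ` A\<rparr>) \<phi>"
  using assms by (auto simp: gmod_iso_def subset_iff intro: bij_betw_subset)

lemma direct_decomposition_subset:
  assumes "direct_decomposition G X A B"
  shows "A \<subseteq> vecs X" "B \<subseteq> vecs X"
  using assms by (auto simp: direct_decomposition_def gsubmodule_def)

lemma direct_decomposition_zero:
  assumes "direct_decomposition G X A B"
  shows "0 \<in> A" "0 \<in> B"
  using assms by (auto simp: direct_decomposition_def)

lemma gsubmodule_image:
  assumes X: "vector_space (scl X)" and Y: "vector_space (scl Y)"
    and \<phi>: "gmod_iso G X Y \<phi>" and A: "gsubmodule G X A"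
  shows "gsubmodule G Y (\<phi> ` A)"
proof -
  interpret X: vector_space "scl X" by fact
  interpret Y: vector_space "scl Y" by fact
  have AX: "A \<subseteq> vecs X" and sub: "X.subspace A" and act: "\<And>g a. \<lbrakk>g \<in> carrier G; a \<in> A\<rbrakk> \<Longrightarrow> act X g a \<in> A"
    using A by (auto simp: gsubmodule_def)
  have add: "\<phi> a + \<phi> a' = \<phi> (a + a')" if "a \<in> A" "a' \<in> A" for a a'
    using \<phi> AX that by (auto simp: gmod_iso_def subset_iff)
  have scale: "scl Y c (\<phi> a) = \<phi> (scl X c a)" if "a \<in> A" for a c
    using \<phi> AX that by (auto simp: gmod_iso_def subset_iff)
  have act': "act Y g (\<phi> a) = \<phi> (act X g a)" if "g \<in> carrier G" "a \<in> A" for a g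
    using \<phi> AX that by (auto simp: gmod_iso_def subset_iff)
  have "\<phi> 0 = 0"
    using add[of 0 0] X.subspace_0[OF sub] by simp
  then have zero: "0 \<in> \<phi> ` A"
    using X.subspace_0[OF sub] by (metis image_eqI)
  have "Y.subspace (\<phi> ` A)"
    by (intro Y.subspaceI zero)
      (auto simp: add scale intro!: imageI X.subspace_add[OF sub] X.subspace_scale[OF sub])
  moreover have "\<phi> ` A \<subseteq> vecs Y"
    using \<phi> AX by (auto simp: gmod_iso_def bij_betw_def)
  moreover have "act Y g w \<in> \<phi> ` A" if "g \<in> carrier G" "w \<in> \<phi> ` A" for g w
    using that act by (auto simp: act')
  ultimately show ?thesis by (simp add: gsubmodule_def)
qed

lemma direct_decomposition_image:
  assumes X: "vector_space (scl X)" and Y: "vector_space (scl Y)"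
    and \<phi>: "gmod_iso G X Y \<phi>" and AB: "direct_decomposition G X A B"
  shows "direct_decomposition G Y (\<phi> ` A) (\<phi> ` B)"
proof -
  have sub: "A \<subseteq> vecs X" "B \<subseteq> vecs X" using direct_decomposition_subset[OF AB] .
  have add: "\<phi> (a + b) = \<phi> a + \<phi> b" if "a \<in> A" "b \<in> B" for a b
    using \<phi> sub that by (auto simp: gmod_iso_def subset_iff)
  have "\<phi> 0 = 0"
    using add[of 0 0] direct_decomposition_zero[OF AB] by simp
  moreover have "\<phi> ` A \<inter> \<phi> ` B = \<phi> ` (A \<inter> B)"
    using \<phi> sub by (intro inj_on_image_Int[symmetric]) (auto simp: gmod_iso_def bij_betw_def)
  ultimately have "\<phi> ` A \<inter> \<phi> ` B = {0}"
    using AB by (simp add: direct_decomposition_def)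
  moreover have "vecs Y = {a + b | a b. a \<in> \<phi> ` A \<and> b \<in> \<phi> ` B}"
  proof -
    have "vecs Y = \<phi> ` vecs X" using \<phi> by (simp add: gmod_iso_def bij_betw_def)
    also have "vecs X = {a + b | a b. a \<in> A \<and> b \<in> B}"
      using AB by (simp add: direct_decomposition_def)
    also have "\<phi> ` \<dots> = {a + b | a b. a \<in> \<phi> ` A \<and> b \<in> \<phi> ` B}"
    proof (intro subset_antisym subsetI)
      fix w assume "w \<in> \<phi> ` {a + b | a b. a \<in> A \<and> b \<in> B}"
      then obtain a b where "a \<in> A" "b \<in> B" "w = \<phi> (a + b)" by blast
      then show "w \<in> {a + b | a b. a \<in> \<phi> ` A \<and> b \<in> \<phi> ` B}" using add by blast
    next
      fix w assume "w \<in> {a + b | a b. a \<in> \<phi> ` A \<and> b \<in> \<phi> ` B}"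
      then obtain a b where "a \<in> A" "b \<in> B" "w = \<phi> a + \<phi> b" by blast
      then show "w \<in> \<phi> ` {a + b | a b. a \<in> A \<and> b \<in> B}" using add by (metis (mono_tags, lifting) CollectI image_eqI)
    qed
    finally show ?thesis .
  qed
  ultimately show ?thesis
    using AB gsubmodule_image[OF X Y \<phi>] by (simp add: direct_decomposition_def)
qed

lemma direct_summand_iso:
  assumes X: "vector_space (scl X)" and Y: "vector_space (scl Y)"
    and \<phi>: "gmod_iso G X Y \<phi>" and M: "direct_summand G M X"
  shows "direct_summand G M Y"
proof -
  obtain A B \<psi> where AB: "direct_decomposition G X A B" and \<psi>: "gmod_iso G M (X\<lparr>vecs := A\<rparr>) \<psi>"
    using M by (auto simp: direct_summand_def gmod_isomorphic_iff)
  have "gmod_iso G M (Y\<lparr>vecs := \<phi> ` A\<rparr>) (\<phi> \<circ> \<psi>)"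
    using \<psi> gmod_iso_restrict[OF \<phi> direct_decomposition_subset(1)[OF AB]] by (rule gmod_iso_trans)
  then show ?thesis
    using direct_decomposition_image[OF X Y \<phi> AB]
    by (auto simp: direct_summand_def gmod_isomorphic_iff)
qed

text \<open>
  Transport of the module axioms onto a structure that is only known to lie in a vector space. The isomorphism is linear only on the vectors of $M$, so that the image of a
  generating set has to be seen to generate by hand.
\<close>

lemma gmodule_iso:
  assumes M: "gmodule G M" and N: "vector_space (scl N)" and \<phi>: "gmod_iso G M N \<phi>"
  shows "gmodule G N"
proof -
  interpret M: gmodule G M by fact
  interpret N: vector_space "scl N" by fact
  have img: "vecs N = \<phi> ` vecs M" using \<phi> by (simp add: gmod_iso_def bij_betw_def)
  have \<phi>':
    "\<And>v w. \<lbrakk>v \<in> vecs M; w \<in> vecs M\<rbrakk> \<Longrightarrow> \<phi> v + \<phi> w = \<phi> (v + w)"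
    "\<And>c v. v \<in> vecs M \<Longrightarrow> scl N c (\<phi> v) = \<phi> (scl M c v)"
    "\<And>g v. \<lbrakk>g \<in> carrier G; v \<in> vecs M\<rbrakk> \<Longrightarrow> act N g (\<phi> v) = \<phi> (act M g v)"
    using \<phi> by (simp_all add: gmod_iso_def)
  note closed = M.act_closed M.subspace_add[OF M.subspace_vecs] M.subspace_scale[OF M.subspace_vecs]
  have M0: "0 \<in> vecs M" using M.subspace_0[OF M.subspace_vecs] .
  then have \<phi>0: "\<phi> 0 = 0" using \<phi>'(1)[of 0 0] by simp
  obtain B where B: "finite B" "vecs M = M.span B" using M.finitely_generated by blast
  have "N.subspace (vecs N)"
    unfolding img by (intro N.subspaceI) (use \<phi>' closed M0 \<phi>0 in \<open>auto intro: rev_image_eqI\<close>)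
  moreover have "\<phi> ` B \<subseteq> vecs N" unfolding img B(2) using M.span_superset by blast
  ultimately have "N.span (\<phi> ` B) \<subseteq> vecs N" by (intro N.span_minimal)
  moreover have "\<phi> v \<in> N.span (\<phi> ` B)" if "v \<in> M.span B" for v
  proof -
    have "M.subspace {v. v \<in> vecs M \<and> \<phi> v \<in> N.span (\<phi> ` B)}"
      by (intro M.subspaceI)
        (auto simp: M0 \<phi>0 closed N.span_zero N.span_add N.span_scale simp flip: \<phi>')
    moreover have "b \<in> vecs M \<and> \<phi> b \<in> N.span (\<phi> ` B)" if "b \<in> B" for b
      using that by (simp add: B(2) M.span_base N.span_base)
    ultimately have "v \<in> vecs M \<and> \<phi> v \<in> N.span (\<phi> ` B)"
      using that by (intro M.span_induct[of v B "\<lambda>v. v \<in> vecs M \<and> \<phi> v \<in> N.span (\<phi> ` B)"])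
    then show ?thesis by blast
  qed
  ultimately have "vecs N = N.span (\<phi> ` B)" unfolding img B(2) by blast
  then have fg: "\<exists>B. finite B \<and> vecs N = N.span B" using B(1) by blast
  show ?thesis
  proof (unfold_locales)
    show "\<exists>B. finite B \<and> vecs N = N.span B" by (rule fg)
  qed (auto simp: img closed M.act_add M.act_scl M.act_one M.act_mult \<phi>')
qed

lemma indecomposable_iso:
  assumes M: "indecomposable G M" and N: "gmodule G N" and \<phi>: "gmod_iso G M N \<phi>"
  shows "indecomposable G N"
proof -
  interpret M: gmodule G M using M by (simp add: indecomposable_def)
  interpret N: gmodule G N by fact
  let ?\<psi> = "inv_into (vecs M) \<phi>"
  have \<psi>: "gmod_iso G N M ?\<psi>"
    using M.gmodule_axioms \<phi> by (rule gmod_iso_inv)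
  have inj: "inj_on ?\<psi> (vecs N)" and img: "vecs M = ?\<psi> ` vecs N"
    using \<psi> by (auto simp: gmod_iso_def bij_betw_def)
  have zero: "{0} \<subseteq> vecs N" using N.subspace_0[OF N.subspace_vecs] by simp
  have "\<forall>v\<in>vecs N. \<forall>w\<in>vecs N. ?\<psi> (v + w) = ?\<psi> v + ?\<psi> w"
    using \<psi> unfolding gmod_iso_def by (elim conjE)
  from bspec[OF bspec[OF this], of 0 0] zero have "?\<psi> (0 + 0) = ?\<psi> 0 + ?\<psi> 0"
    by simp
  then have \<psi>0: "?\<psi> ` {0} = {0}" by simp
  have "A = {0} \<or> B = {0}" if AB: "direct_decomposition G N A B" for A B
  proof -
    have "direct_decomposition G M (?\<psi> ` A) (?\<psi> ` B)"
      using N.vector_space_axioms M.vector_space_axioms \<psi> AB by (rule direct_decomposition_image)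
    then have "?\<psi> ` A = ?\<psi> ` {0} \<or> ?\<psi> ` B = ?\<psi> ` {0}"
      using M unfolding \<psi>0 by (simp add: indecomposable_def)
    then show ?thesis
      using inj_on_image_eq_iff[OF inj direct_decomposition_subset(1)[OF AB] zero]
        inj_on_image_eq_iff[OF inj direct_decomposition_subset(2)[OF AB] zero] by blast
  qed
  moreover have "vecs N \<noteq> {0}"
    using M img \<psi>0 by (metis indecomposable_def)
  ultimately show ?thesis
    using N by (simp add: indecomposable_def)
qed

lemma direct_summand_self:
  assumes "gmodule G X" and \<phi>: "gmod_iso G M X \<phi>"
  shows "direct_summand G M X"
proof -
  interpret gmodule G X by fact
  have "direct_decomposition G X (vecs X) {0}"
  proof -
    have "gsubmodule G X (vecs X)"
      unfolding gsubmodule_def using subspace_vecs act_closed by blast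
    moreover have "gsubmodule G X {0}"
      unfolding gsubmodule_def using subspace_single_0 act_zero subspace_0[OF subspace_vecs] by simp
    ultimately show ?thesis
      using subspace_0[OF subspace_vecs] by (simp add: direct_decomposition_def)
  qed
  moreover have "gmod_iso G M (X\<lparr>vecs := vecs X\<rparr>) \<phi>" using \<phi> by simp
  ultimately show ?thesis
    unfolding direct_summand_def gmod_isomorphic_iff by blast
qed

text \<open>
  The projection onto the first summand is $G$-equivariant because both summands are submodules.
\<close>

lemma direct_decomposition_projection:
  assumes X: "vector_space (scl X)"
    and act_add: "\<And>g v w. \<lbrakk>g \<in> carrier G; v \<in> vecs X; w \<in> vecs X\<rbrakk> \<Longrightarrow>
      act X g (v + w) = act X g v + act X g w"
    and AB: "direct_decomposition G X A B"
  obtains \<pi> where "\<And>w. w \<in> vecs X \<Longrightarrow> \<pi> w \<in> A" "\<And>a. a \<in> A \<Longrightarrow> \<pi> a = a"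
    "\<And>v w. \<lbrakk>v \<in> vecs X; w \<in> vecs X\<rbrakk> \<Longrightarrow> \<pi> (v + w) = \<pi> v + \<pi> w"
    "\<And>g w. \<lbrakk>g \<in> carrier G; w \<in> vecs X\<rbrakk> \<Longrightarrow> \<pi> (act X g w) = act X g (\<pi> w)"
proof -
  interpret vector_space "scl X" by fact
  have sA: "subspace A" and sB: "subspace B" and int: "A \<inter> B = {0}"
    and sum: "vecs X = {a + b | a b. a \<in> A \<and> b \<in> B}"
    and actA: "\<And>g a. \<lbrakk>g \<in> carrier G; a \<in> A\<rbrakk> \<Longrightarrow> act X g a \<in> A"
    and actB: "\<And>g b. \<lbrakk>g \<in> carrier G; b \<in> B\<rbrakk> \<Longrightarrow> act X g b \<in> B"
    and sub: "A \<subseteq> vecs X" "B \<subseteq> vecs X"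
    using AB by (auto simp: direct_decomposition_def gsubmodule_def)
  have uniq: "a = a'" if "a \<in> A" "b \<in> B" "a' \<in> A" "b' \<in> B" "a + b = a' + b'" for a b a' b'
  proof -
    have "a - a' = b' - b" using that(5) by (simp add: algebra_simps)
    then have "a - a' \<in> A \<inter> B"
      using that subspace_diff[OF sA, of a a'] subspace_diff[OF sB, of b' b] by simp
    then show ?thesis by (simp add: int)
  qed
  define \<pi> where "\<pi> w = (SOME a. a \<in> A \<and> (\<exists>b\<in>B. w = a + b))" for w
  have \<pi>: "\<pi> w \<in> A \<and> (\<exists>b\<in>B. w = \<pi> w + b)" if "w \<in> vecs X" for w
    unfolding \<pi>_def by (rule someI_ex) (use that sum in auto)
  have eq: "\<pi> w = a" if "a \<in> A" "b \<in> B" "w = a + b" for w a b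
  proof -
    have "w \<in> vecs X" using that sum by blast
    then obtain b' where "\<pi> w \<in> A" "b' \<in> B" "w = \<pi> w + b'" using \<pi>[of w] by blast
    then show ?thesis using uniq[of "\<pi> w" b' a b] that by simp
  qed
  show thesis
  proof (rule that)
    show "\<pi> w \<in> A" if "w \<in> vecs X" for w using \<pi>[OF that] by blast
    show "\<pi> a = a" if "a \<in> A" for a using eq[OF that subspace_0[OF sB]] by simp
    show "\<pi> (v + w) = \<pi> v + \<pi> w" if vw: "v \<in> vecs X" "w \<in> vecs X" for v w
    proof -
      obtain b b' where b: "b \<in> B" "v = \<pi> v + b" "b' \<in> B" "w = \<pi> w + b'"
        using \<pi>[OF vw(1)] \<pi>[OF vw(2)] by blast
      have "v + w = (\<pi> v + b) + (\<pi> w + b')" by (rule arg_cong2[OF b(2,4)])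
      then have "v + w = (\<pi> v + \<pi> w) + (b + b')" by (simp add: ac_simps)
      moreover have "\<pi> v + \<pi> w \<in> A" "b + b' \<in> B"
        using b \<pi>[OF vw(1)] \<pi>[OF vw(2)] subspace_add[OF sA] subspace_add[OF sB] by blast+
      ultimately show ?thesis by (intro eq)
    qed
    show "\<pi> (act X g w) = act X g (\<pi> w)" if g: "g \<in> carrier G" and w: "w \<in> vecs X" for g w
    proof -
      obtain b where b: "b \<in> B" "w = \<pi> w + b"
        using \<pi>[OF w] by blast
      have \<pi>w: "\<pi> w \<in> A" using \<pi>[OF w] by blast
      have "act X g (\<pi> w + b) = act X g (\<pi> w) + act X g b"
        using act_add[OF g] b(1) \<pi>w sub by blast
      then have "act X g w = act X g (\<pi> w) + act X g b"
        using b(2) by simp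
      with actA[OF g \<pi>w] actB[OF g b(1)] show ?thesis by (rule eq)
    qed
  qed
qed

section \<open>Induced modules and cosets\<close>

lemma induced_simps:
  "scl (induced G Q N) c f = (\<lambda>g. scl N c (f g))"
  "act (induced G Q N) x f = (\<lambda>g. if g \<in> carrier G then f (inv\<^bsub>G\<^esub> x \<otimes>\<^bsub>G\<^esub> g) else 0)"
  by (simp_all add: induced_def)

lemma induced_vecs_iff:
  "f \<in> vecs (induced G Q N) \<longleftrightarrow>
    (\<forall>g\<in>carrier G. f g \<in> vecs N) \<and> (\<forall>g. g \<notin> carrier G \<longrightarrow> f g = 0) \<and>
    (\<forall>g\<in>carrier G. \<forall>q\<in>Q. f (g \<otimes>\<^bsub>G\<^esub> q) = act N (inv\<^bsub>G\<^esub> q) (f g))"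
  by (simp add: induced_def)

lemma vector_space_induced:
  assumes "vector_space (scl N)"
  shows "vector_space (scl (induced G Q N))"
proof -
  interpret vector_space "scl N" by fact
  show ?thesis
    by unfold_locales
      (auto simp: induced_simps fun_eq_iff scale_right_distrib scale_left_distrib)
qed

lemma induced_act_add:
  "act (induced G Q N) x (f + f') = act (induced G Q N) x f + act (induced G Q N) x f'"
  by (auto simp: induced_simps fun_eq_iff)

text \<open>
  Induced modules are realised on functions on $G$, so the component of a vector in the summand
  $gQ \<otimes> N$ of the induced module is its restriction to the coset $gQ$.
\<close>

definition restrict_support :: "'g set \<Rightarrow> ('g \<Rightarrow> 'v::zero) \<Rightarrow> 'g \<Rightarrow> 'v"
  where "restrict_support C f = (\<lambda>g. if g \<in> C then f g else 0)"

lemma (in group) induced_add_closed: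
  assumes Q: "subgroup Q G" and N: "gmodule (G\<lparr>carrier := Q\<rparr>) N"
    and f: "f \<in> vecs (induced G Q N)" "f' \<in> vecs (induced G Q N)"
  shows "f + f' \<in> vecs (induced G Q N)"
proof -
  interpret N: gmodule "G\<lparr>carrier := Q\<rparr>" N by fact
  have "inv q \<in> Q" if "q \<in> Q" for q using Q that by (rule subgroup.m_inv_closed)
  then show ?thesis
    using f N.act_add N.subspace_add[OF N.subspace_vecs]
    by (simp add: induced_vecs_iff)
qed

lemma (in group) induced_zero_closed:
  assumes Q: "subgroup Q G" and N: "gmodule (G\<lparr>carrier := Q\<rparr>) N"
  shows "0 \<in> vecs (induced G Q N)"
proof -
  interpret N: gmodule "G\<lparr>carrier := Q\<rparr>" N by fact
  have "inv q \<in> Q" if "q \<in> Q" for q using Q that by (rule subgroup.m_inv_closed)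
  then show ?thesis
    using N.act_zero N.subspace_0[OF N.subspace_vecs]
    by (simp add: induced_vecs_iff)
qed

lemma (in group) mult_mem_l_coset_iff:
  assumes Q: "subgroup Q G" and "y \<in> carrier G" "g \<in> carrier G" "q \<in> Q"
  shows "g \<otimes> q \<in> y <# Q \<longleftrightarrow> g \<in> y <# Q"
proof -
  have q: "q \<in> carrier G" using Q assms(4) by (rule subgroup.mem_carrier)
  have mem: "x \<in> y <# Q \<longleftrightarrow> inv y \<otimes> x \<in> Q" if "x \<in> carrier G" for x
  proof
    assume "x \<in> y <# Q"
    then obtain q' where "q' \<in> Q" "x = y \<otimes> q'" by (auto simp: l_coset_def)
    then show "inv y \<otimes> x \<in> Q"
      using assms subgroup.mem_carrier[OF Q] by (simp flip: m_assoc)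
  next
    assume "inv y \<otimes> x \<in> Q"
    moreover have "x = y \<otimes> (inv y \<otimes> x)"
      using that assms by (simp flip: m_assoc)
    ultimately show "x \<in> y <# Q" by (auto simp: l_coset_def)
  qed
  have "inv y \<otimes> (g \<otimes> q) = (inv y \<otimes> g) \<otimes> q"
    using assms q by (simp add: m_assoc)
  moreover have "(inv y \<otimes> g) \<otimes> q \<in> Q \<longleftrightarrow> inv y \<otimes> g \<in> Q"
  proof
    assume "(inv y \<otimes> g) \<otimes> q \<in> Q"
    then have "(inv y \<otimes> g) \<otimes> q \<otimes> inv q \<in> Q"
      using assms by (simp add: subgroup.m_closed subgroup.m_inv_closed)
    then show "inv y \<otimes> g \<in> Q" using assms q by (simp add: m_assoc)
  qed (use assms in \<open>simp add: subgroup.m_closed\<close>)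
  ultimately show ?thesis using mem assms q by simp
qed

lemma (in group) induced_restrict_support:
  assumes Q: "subgroup Q G" and N: "gmodule (G\<lparr>carrier := Q\<rparr>) N"
    and f: "f \<in> vecs (induced G Q N)" and y: "y \<in> carrier G"
  shows "restrict_support (y <# Q) f \<in> vecs (induced G Q N)"
proof -
  interpret N: gmodule "G\<lparr>carrier := Q\<rparr>" N by fact
  have "inv q \<in> Q" if "q \<in> Q" for q using Q that by (rule subgroup.m_inv_closed)
  then show ?thesis
    using f y N.act_zero N.subspace_0[OF N.subspace_vecs]
    by (simp add: induced_vecs_iff restrict_support_def mult_mem_l_coset_iff[OF Q])
qed

lemma (in group) sum_restrict_support_l_cosets:
  assumes Q: "subgroup Q G" and fin: "finite (carrier G)"
    and f: "f \<in> vecs (induced G Q N)"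
  shows "(\<Sum>C\<in>(\<lambda>y. y <# Q) ` carrier G. restrict_support C f) = f"
proof
  fix g
  let ?E = "(\<lambda>y. y <# Q) ` carrier G"
  have "(\<Sum>C\<in>S. restrict_support C f) g = (\<Sum>C\<in>S. restrict_support C f g)" for S
    by (induction S rule: infinite_finite_induct) auto
  then have "(\<Sum>C\<in>?E. restrict_support C f) g = (\<Sum>C\<in>?E. restrict_support C f g)" .
  also have "\<dots> = f g"
  proof (cases "g \<in> carrier G")
    case True
    have mem: "g \<in> g <# Q"
      unfolding l_coset_def using True subgroup.one_closed[OF Q] r_one[OF True, symmetric] by blast
    have "C = g <# Q" if CE: "C \<in> ?E" and gC: "g \<in> C" for C
    proof -
      obtain y where "y \<in> carrier G" "C = y <# Q" using CE by blast
      then show ?thesis using l_repr_independence[OF _ _ Q, of g y] gC by simp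
    qed
    then have "restrict_support C f g = (if C = g <# Q then f g else 0)" if "C \<in> ?E" for C
      unfolding restrict_support_def using that mem by metis
    then have "(\<Sum>C\<in>?E. restrict_support C f g) = (\<Sum>C\<in>?E. if C = g <# Q then f g else 0)"
      by (rule sum.cong[OF refl])
    also have "\<dots> = (if g <# Q \<in> ?E then f g else 0)"
      using fin by (intro sum.delta finite_imageI)
    also have "\<dots> = f g"
      using imageI[OF True, of "\<lambda>y. y <# Q"] by (simp only: if_True)
    finally show ?thesis .
  next
    case False
    then have "f g = 0" using f by (simp add: induced_vecs_iff)
    then show ?thesis by (simp add: restrict_support_def sum.neutral)
  qed
  finally show "(\<Sum>C\<in>?E. restrict_support C f) g = f g" .
qed

text \<open>
  Translation by $x$ permutes the summands indexed by the cosets. It therefore permutes the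
  components of a vector that it fixes.
\<close>

lemma (in group) act_restrict_support:
  assumes Q: "subgroup Q G" and f: "f \<in> vecs (induced G Q N)"
    and x: "x \<in> carrier G" and y: "y \<in> carrier G"
    and fixed: "act (induced G Q N) x f = f"
  shows "act (induced G Q N) x (restrict_support (y <# Q) f) = restrict_support (x <# (y <# Q)) f"
proof
  fix g
  have QG: "y <# Q \<subseteq> carrier G"
    using y subgroup.subset[OF Q] by (intro l_coset_subset_G)
  have fg: "f (inv x \<otimes> g) = f g" if "g \<in> carrier G"
    using fun_cong[OF fixed, of g] that by (simp add: induced_simps)
  have iff: "inv x \<otimes> g \<in> y <# Q \<longleftrightarrow> g \<in> x <# (y <# Q)" if "g \<in> carrier G"
  proof
    assume "inv x \<otimes> g \<in> y <# Q"
    moreover have "g = x \<otimes> (inv x \<otimes> g)" using x that by (simp flip: m_assoc)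
    ultimately show "g \<in> x <# (y <# Q)" by (auto simp: l_coset_def[of _ x])
  next
    assume "g \<in> x <# (y <# Q)"
    then obtain z where "z \<in> y <# Q" "g = x \<otimes> z" by (auto simp: l_coset_def[of _ x])
    then show "inv x \<otimes> g \<in> y <# Q" using x QG by (auto simp flip: m_assoc)
  qed
  show "act (induced G Q N) x (restrict_support (y <# Q) f) g = restrict_support (x <# (y <# Q)) f g"
    using f fg iff by (auto simp: induced_simps restrict_support_def induced_vecs_iff)
qed

section \<open>Modules from which a given module is induced\<close>

text \<open>
  The module $g \<otimes> N$ for $gQg^{-1}$, realised on the vectors of the $Q$-module $N$.
\<close>

definition conjugate_module ::
  "('g, 'x) monoid_scheme \<Rightarrow> 'g \<Rightarrow> ('f, 'g, 'v) gmod \<Rightarrow> ('f, 'g, 'v) gmod"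
  where "conjugate_module G g N = N\<lparr>act := \<lambda>x. act N (inv\<^bsub>G\<^esub> g \<otimes>\<^bsub>G\<^esub> x \<otimes>\<^bsub>G\<^esub> g)\<rparr>"

lemma conjugate_module_simps:
  "scl (conjugate_module G g N) = scl N"
  "vecs (conjugate_module G g N) = vecs N"
  "act (conjugate_module G g N) x = act N (inv\<^bsub>G\<^esub> g \<otimes>\<^bsub>G\<^esub> x \<otimes>\<^bsub>G\<^esub> g)"
  by (simp_all add: conjugate_module_def)

lemma (in group) conjugate_subgroupD:
  assumes "x \<in> conjugate_subgroup G g Q"
  shows "x \<in> carrier G" "inv g \<otimes> x \<otimes> g \<in> Q"
  using assms by (auto simp: conjugate_subgroup_def)

lemma (in group) gmodule_conjugate:
  assumes Q: "subgroup Q G" and g: "g \<in> carrier G" and N: "gmodule (G\<lparr>carrier := Q\<rparr>) N"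
  shows "gmodule (G\<lparr>carrier := conjugate_subgroup G g Q\<rparr>) (conjugate_module G g N)"
proof -
  interpret N: gmodule "G\<lparr>carrier := Q\<rparr>" N by fact
  let ?Q = "conjugate_subgroup G g Q"
  have grp: "group (G\<lparr>carrier := ?Q\<rparr>)"
    using subgroup_conjugate_subgroup[OF Q g] by (rule subgroup_imp_group)
  have c: "inv g \<otimes> x \<otimes> g \<in> carrier (G\<lparr>carrier := Q\<rparr>)" if "x \<in> carrier (G\<lparr>carrier := ?Q\<rparr>)" for x
    using that by (simp add: conjugate_subgroup_def)
  have c': "x \<in> carrier G" if "x \<in> carrier (G\<lparr>carrier := ?Q\<rparr>)" for x
    using that by (simp add: conjugate_subgroup_def)
  show ?thesis
  proof (intro gmodule.intro gmodule_axioms.intro grp; (unfold conjugate_module_simps)?)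
    show "vector_space (scl N)" by (rule N.vector_space_axioms)
    show "\<exists>B. finite B \<and> vecs N = N.span B" by (rule N.finitely_generated)
  next
    fix v assume "v \<in> vecs N"
    then show "act N (inv g \<otimes> \<one>\<^bsub>G\<lparr>carrier := ?Q\<rparr>\<^esub> \<otimes> g) v = v"
      using g N.act_one by simp
  next
    fix x y v
    assume xy: "x \<in> carrier (G\<lparr>carrier := ?Q\<rparr>)" "y \<in> carrier (G\<lparr>carrier := ?Q\<rparr>)" and v: "v \<in> vecs N"
    show "act N (inv g \<otimes> (x \<otimes>\<^bsub>G\<lparr>carrier := ?Q\<rparr>\<^esub> y) \<otimes> g) v =
        act N (inv g \<otimes> x \<otimes> g) (act N (inv g \<otimes> y \<otimes> g) v)"
      using N.act_mult[OF c[OF xy(1)] c[OF xy(2)] v] conjugate_mult[OF g c'[OF xy(1)] c'[OF xy(2)]]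
      by simp
  qed (use c in \<open>auto intro: N.act_closed N.act_add N.act_scl\<close>)
qed

lemma (in group) indecomposable_conjugate:
  assumes Q: "subgroup Q G" and g: "g \<in> carrier G"
    and N: "indecomposable (G\<lparr>carrier := Q\<rparr>) N"
  shows "indecomposable (G\<lparr>carrier := conjugate_subgroup G g Q\<rparr>) (conjugate_module G g N)"
proof -
  let ?Q = "conjugate_subgroup G g Q" and ?N = "conjugate_module G g N"
  have img: "(\<lambda>x. inv g \<otimes> x \<otimes> g) ` ?Q = Q"
    using conjugate_subgroup_bij_betw[OF Q g] by (simp add: bij_betw_def)
  have "(\<forall>x\<in>?Q. \<forall>w\<in>W. act N (inv g \<otimes> x \<otimes> g) w \<in> W) \<longleftrightarrow>
      (\<forall>q\<in>(\<lambda>x. inv g \<otimes> x \<otimes> g) ` ?Q. \<forall>w\<in>W. act N q w \<in> W)" for W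
    by blast
  then have "gsubmodule (G\<lparr>carrier := ?Q\<rparr>) ?N = gsubmodule (G\<lparr>carrier := Q\<rparr>) N"
    by (simp add: fun_eq_iff gsubmodule_def conjugate_module_simps img)
  then have "direct_decomposition (G\<lparr>carrier := ?Q\<rparr>) ?N = direct_decomposition (G\<lparr>carrier := Q\<rparr>) N"
    by (simp add: fun_eq_iff direct_decomposition_def conjugate_module_simps)
  then show ?thesis
    using N gmodule_conjugate[OF Q g, of N]
    by (simp add: indecomposable_def conjugate_module_simps)
qed

text \<open>
  Right translation by $g$ turns the cosets of $gQg^{-1}$ into the cosets of $Q$, since
  $x(gQg^{-1})g = (xg)Q$.
\<close>

lemma (in group) induced_conjugate_iso:
  assumes Q: "subgroup Q G" and g: "g \<in> carrier G" and N: "vector_space (scl N)"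
  shows "gmod_iso G (induced G Q N)
    (induced G (conjugate_subgroup G g Q) (conjugate_module G g N))
    (\<lambda>f x. if x \<in> carrier G then f (x \<otimes> g) else 0)"
proof -
  let ?X = "induced G Q N" and ?Y = "induced G (conjugate_subgroup G g Q) (conjugate_module G g N)"
  let ?\<phi> = "\<lambda>f x. if x \<in> carrier G then f (x \<otimes> g) else 0"
  let ?\<psi> = "\<lambda>f x. if x \<in> carrier G then f (x \<otimes> inv g) else 0"
  have cancel: "x \<otimes> g \<otimes> inv g = x" "x \<otimes> inv g \<otimes> g = x" if "x \<in> carrier G" for x
    using g that by (simp_all add: m_assoc)
  have "bij_betw ?\<phi> (vecs ?X) (vecs ?Y)"
  proof (rule bij_betw_byWitness[where f' = ?\<psi>])
    show "\<forall>f\<in>vecs ?X. ?\<psi> (?\<phi> f) = f" "\<forall>f\<in>vecs ?Y. ?\<phi> (?\<psi> f) = f"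
      using g by (simp_all add: induced_vecs_iff fun_eq_iff cancel)
    show "?\<phi> ` vecs ?X \<subseteq> vecs ?Y"
    proof (intro image_subsetI)
      fix f assume f: "f \<in> vecs ?X"
      have "f (x \<otimes> q \<otimes> g) = act N (inv g \<otimes> inv q \<otimes> g) (f (x \<otimes> g))"
        if x: "x \<in> carrier G" and q: "q \<in> conjugate_subgroup G g Q" for x q
      proof -
        note q' = conjugate_subgroupD[OF q]
        have "x \<otimes> q \<otimes> g = (x \<otimes> g) \<otimes> (inv g \<otimes> q \<otimes> g)"
          using g x q'(1) by (simp add: cancel flip: m_assoc)
        then show ?thesis
          using f x g q' by (simp add: induced_vecs_iff conjugate_inv)
      qed
      then show "?\<phi> f \<in> vecs ?Y"
        using f g by (auto simp: induced_vecs_iff conjugate_module_simps dest: conjugate_subgroupD)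
    qed
    show "?\<psi> ` vecs ?Y \<subseteq> vecs ?X"
    proof (intro image_subsetI)
      fix f assume f: "f \<in> vecs ?Y"
      have "f (x \<otimes> q \<otimes> inv g) = act N (inv q) (f (x \<otimes> inv g))"
        if x: "x \<in> carrier G" and q: "q \<in> Q" for x q
      proof -
        have qG: "q \<in> carrier G" using Q q by (rule subgroup.mem_carrier)
        have conj: "g \<otimes> q \<otimes> inv g \<in> conjugate_subgroup G g Q"
          using g q qG by (simp add: conjugate_subgroup_def inverse_conjugate_conjugate)
        have "x \<otimes> q \<otimes> inv g = (x \<otimes> inv g) \<otimes> (g \<otimes> q \<otimes> inv g)"
          using g x qG by (simp add: cancel flip: m_assoc)
        moreover have "inv g \<otimes> inv (g \<otimes> q \<otimes> inv g) \<otimes> g = inv q"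
          using g qG by (simp add: conjugate_inv inverse_conjugate_conjugate)
        ultimately show ?thesis
          using f x g conj by (simp add: induced_vecs_iff conjugate_module_simps)
      qed
      then show "?\<psi> f \<in> vecs ?X"
        using f g subgroup.mem_carrier[OF Q]
        by (auto simp: induced_vecs_iff conjugate_module_simps)
    qed
  qed
  moreover have "scl N c 0 = 0" for c
  proof -
    interpret vector_space "scl N" by fact
    show ?thesis by simp
  qed
  ultimately show ?thesis
    using g by (auto simp: gmod_iso_def induced_simps conjugate_module_simps fun_eq_iff m_assoc)
qed

lemma (in group) summand_of_induced_conjugate:
  fixes M :: "('f::field, 'a, 'v::ab_group_add) gmod"
  assumes M: "summand_of_induced G M Q" and g: "g \<in> carrier G"
  shows "summand_of_induced G M (conjugate_subgroup G g Q)"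
proof -
  obtain N :: "('f, 'a, nat \<Rightarrow> 'f) gmod" where Q: "subgroup Q G"
    and N: "indecomposable (G\<lparr>carrier := Q\<rparr>) N" and MN: "direct_summand G M (induced G Q N)"
    using M by (auto simp: summand_of_induced_def)
  interpret N: gmodule "G\<lparr>carrier := Q\<rparr>" N using N by (simp add: indecomposable_def)
  have "direct_summand G M (induced G (conjugate_subgroup G g Q) (conjugate_module G g N))"
    using _ _ induced_conjugate_iso[OF Q g N.vector_space_axioms] MN
    by (rule direct_summand_iso)
      (simp_all add: vector_space_induced conjugate_module_simps N.vector_space_axioms)
  then show ?thesis
    using subgroup_conjugate_subgroup[OF Q g] indecomposable_conjugate[OF Q g N]
    by (auto simp: summand_of_induced_def)
qed

text \<open>
  A vector of the module induced from $G$ to $G$ is determined by its value at the identity.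
\<close>

lemma (in group) induced_carrier_iso:
  assumes N: "gmodule G N"
  shows "gmod_iso G N (induced G (carrier G) N) (\<lambda>w g. if g \<in> carrier G then act N (inv g) w else 0)"
proof -
  interpret N: gmodule G N by fact
  let ?X = "induced G (carrier G) N"
  let ?\<phi> = "\<lambda>w g. if g \<in> carrier G then act N (inv g) w else 0"
  have "bij_betw ?\<phi> (vecs N) (vecs ?X)"
  proof (rule bij_betw_byWitness[where f' = "\<lambda>f. f \<one>"])
    show "\<forall>w\<in>vecs N. ?\<phi> w \<one> = w" by (simp add: N.act_one)
    show "\<forall>f\<in>vecs ?X. ?\<phi> (f \<one>) = f"
    proof (intro ballI ext)
      fix f g assume f: "f \<in> vecs ?X"
      have "f (\<one> \<otimes> g) = act N (inv g) (f \<one>)" if "g \<in> carrier G"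
        using f that one_closed unfolding induced_vecs_iff by blast
      then show "?\<phi> (f \<one>) g = f g" using f by (simp add: induced_vecs_iff)
    qed
    show "?\<phi> ` vecs N \<subseteq> vecs ?X"
      by (auto simp: induced_vecs_iff N.act_closed N.act_mult inv_mult_group)
    show "(\<lambda>f. f \<one>) ` vecs ?X \<subseteq> vecs N"
      by (auto simp: induced_vecs_iff)
  qed
  then show ?thesis
    by (auto simp: gmod_iso_def induced_simps fun_eq_iff N.act_add N.act_scl N.act_mult inv_mult_group)
qed

text \<open>
  The definition of a vertex only quantifies over modules whose vectors are sequences. Coordinates
  with respect to a finite basis embed every module in this type.
\<close>

lemma gmodule_isomorphic_to_sequences:
  fixes M :: "('f::field, 'g, 'v::ab_group_add) gmod"
  assumes M: "gmodule G M"
  shows "\<exists>N :: ('f, 'g, nat \<Rightarrow> 'f) gmod. gmodule G N \<and> gmod_isomorphic G M N"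
proof -
  interpret M: gmodule G M by fact
  define s where "s = (\<lambda>(c::'f) (f::nat \<Rightarrow> 'f) i. c * f i)"
  interpret vector_space_pair "scl M" s
    by unfold_locales (auto simp: s_def fun_eq_iff algebra_simps)
  obtain B where B: "B \<subseteq> vecs M" "M.independent B" "vecs M \<subseteq> M.span B"
    by (rule M.maximal_independent_subset)
  have span_B: "vecs M = M.span B"
    using B M.span_minimal[OF B(1) M.subspace_vecs] by blast
  have finB: "finite B"
    using M.finitely_generated B(1,2) M.independent_span_bound by metis
  obtain \<iota> :: "'v \<Rightarrow> nat" where \<iota>: "inj_on \<iota> B"
    using finite_imp_inj_to_nat_seg[OF finB] by blast
  \<comment> \<open>The standard basis vectors of the space of sequences.\<close>
  define e where "e b = (\<lambda>i. if i = \<iota> b then 1 else (0::'f))" for b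
  have e_inj: "inj_on e B"
    using \<iota> by (auto simp: e_def inj_on_def fun_eq_iff split: if_splits)
  have e_indep: "vs2.independent (e ` B)"
    unfolding vs2.independent_explicit_module
  proof (intro allI impI)
    fix T u v
    assume T: "finite T" "T \<subseteq> e ` B" and sum: "(\<Sum>v\<in>T. s (u v) v) = 0" and v: "v \<in> T"
    obtain b where b: "b \<in> B" "v = e b" using T v by blast
    have eval: "(\<Sum>v\<in>S. s (u v) v) i = (\<Sum>v\<in>S. u v * v i)" for S i
      by (induction S rule: infinite_finite_induct) (auto simp: s_def)
    have val: "w (\<iota> b) = (if w = v then 1 else 0)" if w: "w \<in> T" for w
    proof -
      obtain b' where "b' \<in> B" "w = e b'" using T w by blast
      then show ?thesis
        using b inj_on_eq_iff[OF \<iota>, of b' b] inj_on_eq_iff[OF e_inj, of b' b] by (auto simp: e_def)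
    qed
    then have "u w * w (\<iota> b) = (if w = v then u w else 0)" if "w \<in> T" for w
      by (simp add: val[OF that])
    then have "(\<Sum>w\<in>T. u w * w (\<iota> b)) = (\<Sum>w\<in>T. if w = v then u w else 0)"
      by (rule sum.cong[OF refl])
    also have "\<dots> = u v" using T(1) v by simp
    finally show "u v = 0" using eval[of T "\<iota> b"] sum by simp
  qed
  define \<phi> where "\<phi> = construct B e"
  interpret \<phi>: Vector_Spaces.linear "scl M" s \<phi>
    unfolding \<phi>_def using B(2) by (rule linear_construct)
  have img: "\<phi> ` B = e ` B"
    unfolding \<phi>_def using construct_basis[OF B(2)] by (rule image_cong[OF refl])
  have inj_B: "inj_on \<phi> B"
    using e_inj construct_basis[OF B(2), of _ e] by (simp add: inj_on_def \<phi>_def)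
  have inj: "inj_on \<phi> (vecs M)"
    unfolding span_B using e_indep inj_B by (intro \<phi>.inj_on_span_independent_image) (simp_all add: img)
  \<comment> \<open>The action on the image is defined through a preimage, which is unique.\<close>
  define N where "N = \<lparr>scl = s, vecs = \<phi> ` vecs M,
    act = (\<lambda>g w. \<phi> (act M g (inv_into (vecs M) \<phi> w)))\<rparr>"
  have iso: "gmod_iso G M N \<phi>"
    using inj by (simp add: gmod_iso_def N_def bij_betw_def \<phi>.add \<phi>.scale)
  have "gmodule G N"
  proof (rule gmodule_iso[OF M _ iso])
    show "vector_space (scl N)" by (simp add: N_def vs2.vector_space_axioms)
  qed
  then show ?thesis using iso gmod_isomorphic_iff by blast
qed

lemma (in group) summand_of_induced_carrier:
  fixes M :: "('f::field, 'a, 'v::ab_group_add) gmod"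
  assumes M: "indecomposable G M"
  shows "summand_of_induced G M (carrier G)"
proof -
  have gM: "gmodule G M" using M by (simp add: indecomposable_def)
  obtain N :: "('f, 'a, nat \<Rightarrow> 'f) gmod" and \<phi> where N: "gmodule G N" and \<phi>: "gmod_iso G M N \<phi>"
    using gmodule_isomorphic_to_sequences[OF gM] by (auto simp: gmod_isomorphic_iff)
  interpret N: gmodule G N by fact
  have "indecomposable (G\<lparr>carrier := carrier G\<rparr>) N"
    using indecomposable_iso[OF M N \<phi>] by simp
  moreover have "direct_summand G M (induced G (carrier G) N)"
    using N.vector_space_axioms vector_space_induced[OF N.vector_space_axioms]
      induced_carrier_iso[OF N] direct_summand_self[OF N \<phi>]
    by (rule direct_summand_iso)
  ultimately show ?thesis
    using subgroup_self by (auto simp: summand_of_induced_def)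
qed

section \<open>Fixed vectors and vertices\<close>

text \<open>
  This is the part of the theory of Brauer quotients that the theorem rests on. A $P$-fixed vector
  $v$ and a $P$-invariant linear functional that does not vanish at $v$ split off a trivial summand of
  the restriction of $M$ to $P$; such a summand can only come from a coset $gQ$ fixed by $P$. To find
  this coset, the value at $v$ is written as a sum of contributions of the cosets, which would
  vanish in characteristic $p$ if $P$ moved all of them.
\<close>

lemma (in group) fixed_vector_imp_subset_conjugate:
  fixes N :: "('f::field, 'a, 'w::ab_group_add) gmod"
    and M :: "('f, 'a, 'v::ab_group_add) gmod" and \<theta> :: "'v \<Rightarrow> 'f"
  assumes fin: "finite (carrier G)" and M: "gmodule G M"
    and Q: "subgroup Q G" and N: "gmodule (G\<lparr>carrier := Q\<rparr>) N"
    and MN: "direct_summand G M (induced G Q N)"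
    and P: "subgroup P G" and card_P: "card P = CHAR('f) ^ k" and p: "prime CHAR('f)"
    and v: "v \<in> vecs M" and v_fixed: "\<And>h. h \<in> P \<Longrightarrow> act M h v = v"
    and \<theta>_add: "\<And>w w'. \<lbrakk>w \<in> vecs M; w' \<in> vecs M\<rbrakk> \<Longrightarrow> \<theta> (w + w') = \<theta> w + \<theta> w'"
    and \<theta>_act: "\<And>h w. \<lbrakk>h \<in> P; w \<in> vecs M\<rbrakk> \<Longrightarrow> \<theta> (act M h w) = \<theta> w"
    and \<theta>_v: "\<theta> v \<noteq> 0"
  shows "\<exists>g\<in>carrier G. P \<subseteq> conjugate_subgroup G g Q"
proof (rule ccontr)
  assume not_conj: "\<not> ?thesis"
  let ?X = "induced G Q N" and ?E = "(\<lambda>x. x <# Q) ` carrier G"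
  interpret M: gmodule G M by fact
  interpret N: gmodule "G\<lparr>carrier := Q\<rparr>" N by fact
  have QG: "Q \<subseteq> carrier G" and PG: "P \<subseteq> carrier G"
    using Q P by (auto dest: subgroup.subset)
  obtain A B \<phi> where AB: "direct_decomposition G ?X A B"
    and \<phi>: "gmod_iso G M (?X\<lparr>vecs := A\<rparr>) \<phi>"
    using MN by (auto simp: direct_summand_def gmod_isomorphic_iff)
  obtain \<pi> where \<pi>: "\<And>w. w \<in> vecs ?X \<Longrightarrow> \<pi> w \<in> A" "\<And>a. a \<in> A \<Longrightarrow> \<pi> a = a"
    "\<And>v w. \<lbrakk>v \<in> vecs ?X; w \<in> vecs ?X\<rbrakk> \<Longrightarrow> \<pi> (v + w) = \<pi> v + \<pi> w"
    "\<And>g w. \<lbrakk>g \<in> carrier G; w \<in> vecs ?X\<rbrakk> \<Longrightarrow> \<pi> (act ?X g w) = act ?X g (\<pi> w)"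
    using direct_decomposition_projection[OF vector_space_induced[OF N.vector_space_axioms]
        induced_act_add AB] by blast
  define \<psi> where "\<psi> = inv_into (vecs M) \<phi>"
  have \<psi>: "gmod_iso G (?X\<lparr>vecs := A\<rparr>) M \<psi>"
    unfolding \<psi>_def using M \<phi> by (rule gmod_iso_inv)
  have \<psi>_vecs: "\<psi> a \<in> vecs M" if "a \<in> A" for a
    using \<psi> that by (auto simp: gmod_iso_def dest: bij_betwE)
  have \<psi>_add: "\<psi> (a + a') = \<psi> a + \<psi> a'" if "a \<in> A" "a' \<in> A" for a a'
    using \<psi> that by (simp add: gmod_iso_def)
  have \<psi>_act: "\<psi> (act ?X g a) = act M g (\<psi> a)" if "g \<in> carrier G" "a \<in> A" for a g
    using \<psi> that by (simp add: gmod_iso_def)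
  \<comment> \<open>The functional \<open>L\<close> on the induced module is \<open>\<theta>\<close> after the projection onto the summand
    isomorphic to \<open>M\<close>.\<close>
  define L where "L w = \<theta> (\<psi> (\<pi> w))" for w
  have L_add: "L (w + w') = L w + L w'" if "w \<in> vecs ?X" "w' \<in> vecs ?X" for w w'
    using that \<pi> by (simp add: L_def \<psi>_add \<psi>_vecs \<theta>_add)
  have L_act: "L (act ?X h w) = L w" if "h \<in> P" "w \<in> vecs ?X" for h w
    using that PG \<pi> by (simp add: L_def subset_iff \<psi>_act \<psi>_vecs \<theta>_act)
  have X0: "0 \<in> vecs ?X" using Q N by (rule induced_zero_closed)
  have L_zero: "L 0 = 0"
  proof -
    have "L 0 + 0 = L (0 + 0)" by (simp only: add_0_right)
    then have "L 0 + 0 = L 0 + L 0" by (simp only: L_add[OF X0 X0])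
    then show ?thesis by (simp only: add_left_cancel)
  qed
  have L_sum: "sum F S \<in> vecs ?X \<and> L (sum F S) = (\<Sum>s\<in>S. L (F s))"
    if "finite S" "\<And>s. s \<in> S \<Longrightarrow> F s \<in> vecs ?X" for F :: "'a set \<Rightarrow> 'a \<Rightarrow> 'w" and S
    using that
  proof (induction S)
    case empty
    then show ?case using X0 L_zero by (simp only: sum.empty)
  next
    case (insert s S)
    then have IH: "sum F S \<in> vecs ?X" "L (sum F S) = (\<Sum>s\<in>S. L (F s))" "F s \<in> vecs ?X"
      by blast+
    show ?case
      using induced_add_closed[OF Q N IH(3,1)] L_add[OF IH(3,1)] IH(2)
      by (simp only: sum.insert[OF insert.hyps])
  qed
  define x where "x = \<phi> v"
  have xA: "x \<in> A"
    using \<phi> v by (auto simp: x_def gmod_iso_def dest: bij_betwE)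
  then have x: "x \<in> vecs ?X" using direct_decomposition_subset(1)[OF AB] by blast
  have x_fixed: "act ?X h x = x" if "h \<in> P" for h
  proof -
    have "act ?X h (\<phi> v) = \<phi> (act M h v)"
      using \<phi> v that PG by (auto simp: gmod_iso_def)
    then show ?thesis using v_fixed that by (simp add: x_def)
  qed
  have "\<psi> x = v"
    using \<phi> v unfolding \<psi>_def x_def by (intro bij_betw_inv_into_left) (auto simp: gmod_iso_def)
  then have L_x: "L x \<noteq> 0"
    using \<theta>_v \<pi>(2)[OF xA] by (simp add: L_def)
  define c where "c C = L (restrict_support C x)" for C
  have xC: "restrict_support C x \<in> vecs ?X" if "C \<in> ?E" for C
    using that induced_restrict_support[OF Q N x] by blast
  have "L x = (\<Sum>C\<in>?E. c C)"
    using L_sum[of ?E "\<lambda>C. restrict_support C x"] xC fin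
      sum_restrict_support_l_cosets[OF Q fin x] by (simp add: c_def)
  also have "\<dots> = 0"
  proof -
    let ?\<phi> = "\<lambda>h. \<lambda>C\<in>?E. h <# C"
    interpret action: group_action "G\<lparr>carrier := P\<rparr>" ?E ?\<phi>
      using Q P by (rule l_coset_action)
    show ?thesis
    proof (rule action.sum_invariant_eq_0[OF _ _ p])
      show "finite ?E" using fin by simp
      show "order (G\<lparr>carrier := P\<rparr>) = CHAR('f) ^ k" using card_P by (simp add: order_def)
      show "c (?\<phi> h C) = c C" if h: "h \<in> carrier (G\<lparr>carrier := P\<rparr>)" and C: "C \<in> ?E" for h C
      proof -
        have "h \<in> P" "h \<in> carrier G" using h PG by auto
        moreover obtain y where y: "y \<in> carrier G" "C = y <# Q" using C by blast
        ultimately have "restrict_support (h <# C) x = act ?X h (restrict_support C x)"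
          using act_restrict_support[OF Q x _ y(1), of h] x_fixed by simp
        then show ?thesis
          using C L_act[OF \<open>h \<in> P\<close> xC[OF C]] by (simp add: c_def)
      qed
      show "\<exists>h\<in>carrier (G\<lparr>carrier := P\<rparr>). ?\<phi> h C \<noteq> C" if C: "C \<in> ?E" for C
      proof (rule ccontr)
        assume "\<not> ?thesis"
        \<comment> \<open>A coset that is fixed by \<open>P\<close> puts \<open>P\<close> into a conjugate of \<open>Q\<close>.\<close>
        then have fixed: "h <# C = C" if "h \<in> P" for h using C that by auto
        obtain g where g: "g \<in> carrier G" "C = g <# Q" using C by blast
        have "inv g \<otimes> h \<otimes> g \<in> Q" if h: "h \<in> P" for h
        proof -
          have hG: "h \<in> carrier G" using h PG by blast
          have "g \<otimes> \<one> \<in> C" using g(2) subgroup.one_closed[OF Q] by (auto simp: l_coset_def)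
          then have "h \<otimes> g \<in> h <# C" using g(1) by (auto simp: l_coset_def)
          then obtain q where q: "q \<in> Q" "h \<otimes> g = g \<otimes> q"
            using fixed[OF h] g(2) by (auto simp: l_coset_def)
          have "inv g \<otimes> h \<otimes> g = inv g \<otimes> (g \<otimes> q)"
            using g(1) hG q(2) by (simp add: m_assoc)
          also have "\<dots> = q" using g(1) q(1) QG by (auto simp flip: m_assoc)
          finally show ?thesis using q(1) by simp
        qed
        then have "P \<subseteq> conjugate_subgroup G g Q"
          using PG by (auto simp: conjugate_subgroup_def)
        then show False using not_conj g(1) by blast
      qed
    qed
  qed
  finally show False using L_x by simp
qed

text \<open>
  A vertex is taken of least order, not merely minimal under inclusion: conjugation preserves the
  order, so that the conjugate containing $P$ is again minimal.
\<close>

lemma (in group) vertex_containing: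
  fixes M :: "('f::field, 'a, 'v::ab_group_add) gmod" and \<theta> :: "'v \<Rightarrow> 'f"
  assumes fin: "finite (carrier G)" and M: "indecomposable G M"
    and P: "subgroup P G" and card_P: "card P = CHAR('f) ^ k" and p: "prime CHAR('f)"
    and v: "v \<in> vecs M" and v_fixed: "\<And>h. h \<in> P \<Longrightarrow> act M h v = v"
    and \<theta>_add: "\<And>w w'. \<lbrakk>w \<in> vecs M; w' \<in> vecs M\<rbrakk> \<Longrightarrow> \<theta> (w + w') = \<theta> w + \<theta> w'"
    and \<theta>_act: "\<And>h w. \<lbrakk>h \<in> P; w \<in> vecs M\<rbrakk> \<Longrightarrow> \<theta> (act M h w) = \<theta> w"
    and \<theta>_v: "\<theta> v \<noteq> 0"
  shows "\<exists>Q. is_vertex G M Q \<and> P \<subseteq> Q"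
proof -
  have gM: "gmodule G M" using M by (simp add: indecomposable_def)
  obtain Q where Q: "summand_of_induced G M Q"
    and min: "\<And>R. summand_of_induced G M R \<Longrightarrow> card Q \<le> card R"
    using arg_min_nat_lemma[of "summand_of_induced G M" "carrier G" card]
      summand_of_induced_carrier[OF M] by blast
  obtain N :: "('f, 'a, nat \<Rightarrow> 'f) gmod" where subQ: "subgroup Q G"
    and N: "gmodule (G\<lparr>carrier := Q\<rparr>) N" and MN: "direct_summand G M (induced G Q N)"
    using Q by (auto simp: summand_of_induced_def indecomposable_def)
  obtain g where g: "g \<in> carrier G" and sub: "P \<subseteq> conjugate_subgroup G g Q"
    using fixed_vector_imp_subset_conjugate[OF fin gM subQ N MN P card_P p v v_fixed \<theta>_add \<theta>_act \<theta>_v]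
    by blast
  have fin': "finite (conjugate_subgroup G g Q)"
    using fin by (simp add: conjugate_subgroup_def)
  have "R = conjugate_subgroup G g Q"
    if "summand_of_induced G M R" "R \<subseteq> conjugate_subgroup G g Q" for R
    using card_seteq[OF fin' that(2)] min[OF that(1)] card_conjugate_subgroup[OF subQ g] by simp
  then have "is_vertex G M (conjugate_subgroup G g Q)"
    using summand_of_induced_conjugate[OF Q g] by (simp add: is_vertex_def)
  then show ?thesis using sub by blast
qed

section \<open>Tabloids and polytabloids\<close>

lemma row_entries_comp: "row_entries l (g \<circ> t) i = g ` row_entries l t i"
  by (auto simp: row_entries_def)

lemma tableau_comp:
  assumes "tableau l t" "g permutes {1..sum_list l}"
  shows "tableau l (g \<circ> t)"
  using assms unfolding tableau_def by (blast intro: bij_betw_trans permutes_imp_bij)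

lemma tabloid_act_comp: "tabloid_act g (tabloid_act h T) = tabloid_act (g \<circ> h) T"
  by (simp add: tabloid_act_def image_image comp_assoc)

lemma tabloid_act_id: "tabloid_act id T = T"
  by (simp add: tabloid_act_def)

lemma tabloid_act_inv_eq_iff:
  assumes "g permutes A"
  shows "tabloid_act (inv' g) S = T \<longleftrightarrow> S = tabloid_act g T"
  using permutes_inv_o[OF assms] by (metis tabloid_act_comp tabloid_act_id)

lemma tabloid_act_tabloid_of:
  assumes t: "tableau l t" and g: "g permutes {1..sum_list l}"
  shows "tabloid_act g (tabloid_of l t) = tabloid_of l (g \<circ> t)"
proof -
  have incl: "tabloid_act g (tabloid_of l t) \<subseteq> tabloid_of l (g \<circ> t)"
    if "g permutes {1..sum_list l}" for g t
    using that by (auto simp: tabloid_act_def tabloid_of_def tableau_comp row_entries_comp)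
  have "tabloid_act (inv' g) (tabloid_of l (g \<circ> t)) \<subseteq> tabloid_of l (inv' g \<circ> (g \<circ> t))"
    using g by (intro incl permutes_inv)
  also have "inv' g \<circ> (g \<circ> t) = t"
    by (simp add: permutes_inv_o(2)[OF g] flip: comp_assoc)
  finally have "tabloid_act g (tabloid_act (inv' g) (tabloid_of l (g \<circ> t))) \<subseteq>
      tabloid_act g (tabloid_of l t)"
    unfolding tabloid_act_def by (rule image_mono)
  then have "tabloid_of l (g \<circ> t) \<subseteq> tabloid_act g (tabloid_of l t)"
    by (simp add: tabloid_act_comp permutes_inv_o(1)[OF g] tabloid_act_id)
  with incl[OF g] show ?thesis by blast
qed

lemma tabloid_act_row_stabiliser:
  assumes t: "tableau l t" and h: "h \<in> row_stabiliser l t"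
  shows "tabloid_act h (tabloid_of l t) = tabloid_of l t"
proof -
  have "h permutes {1..sum_list l}"
    using h by (simp add: row_stabiliser_def sym_group_carrier)
  then have "tabloid_act h (tabloid_of l t) = tabloid_of l (h \<circ> t)"
    using t by (intro tabloid_act_tabloid_of)
  also have "\<dots> = tabloid_of l t"
    using h by (simp add: tabloid_of_def row_entries_comp row_stabiliser_def)
  finally show ?thesis .
qed

text \<open>
  A permutation that preserves all rows and all columns fixes every entry, because a row and a
  column meet in at most one box.
\<close>

lemma column_stabiliser_tabloid_act_eq_imp_id:
  assumes t: "tableau l t" and g: "g \<in> column_stabiliser l t"
    and fixed: "tabloid_act g (tabloid_of l t) = tabloid_of l t"
  shows "g = id"
proof
  fix x
  have perm: "g permutes {1..sum_list l}"
    using g by (simp add: column_stabiliser_def sym_group_carrier)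
  have inj: "inj_on t (young_diagram l)" and img: "t ` young_diagram l = {1..sum_list l}"
    using t by (auto simp: tableau_def bij_betw_def)
  have "g \<circ> t \<in> tabloid_act g (tabloid_of l t)"
    using t by (auto simp: tabloid_act_def tabloid_of_def)
  then have rows: "g ` row_entries l t i = row_entries l t i" for i
    unfolding fixed by (simp add: tabloid_of_def row_entries_comp)
  have columns: "g ` column_entries l t j = column_entries l t j" for j
    using g by (simp add: column_stabiliser_def)
  show "g x = id x"
  proof (cases "x \<in> {1..sum_list l}")
    case True
    then obtain i j where ij: "(i, j) \<in> young_diagram l" "x = t (i, j)"
      using img by (metis imageE surj_pair)
    have "x \<in> row_entries l t i" "x \<in> column_entries l t j"
      using ij by (auto simp: row_entries_def column_entries_def)
    then have "g x \<in> g ` row_entries l t i" "g x \<in> g ` column_entries l t j"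
      by (simp_all only: imageI)
    then have "g x \<in> row_entries l t i" "g x \<in> column_entries l t j"
      unfolding rows columns .
    then obtain i' j' where "(i, j') \<in> young_diagram l" "g x = t (i, j')"
      "(i', j) \<in> young_diagram l" "g x = t (i', j)"
      by (auto simp: row_entries_def column_entries_def)
    then show ?thesis using inj ij by (auto dest: inj_onD)
  next
    case False
    then show ?thesis using perm by (simp add: permutes_not_in)
  qed
qed

text \<open>
  That the inverse of $h$ again maps columns to columns is not evident from the definition; it follows
  from closure under products by finiteness.
\<close>

lemma subgroup_column_permuting_group:
  "subgroup (column_permuting_group l t) (sym_group (sum_list l))"
proof -
  interpret group "sym_group (sum_list l)" by (rule sym_group_is_group)
  show ?thesis
  proof (rule finite_submonoid_imp_subgroup)
    show sub: "column_permuting_group l t \<subseteq> carrier (sym_group (sum_list l))"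
      by (auto simp: column_permuting_group_def row_stabiliser_def)
    show "finite (column_permuting_group l t)"
      using sub by (rule finite_subset) (simp add: sym_group_def finite_permutations)
    show "\<one>\<^bsub>sym_group (sum_list l)\<^esub> \<in> column_permuting_group l t"
      by (auto simp: column_permuting_group_def row_stabiliser_def sym_group_def permutes_id)
    show "a \<otimes>\<^bsub>sym_group (sum_list l)\<^esub> b \<in> column_permuting_group l t"
      if "a \<in> column_permuting_group l t" "b \<in> column_permuting_group l t" for a b
    proof -
      have "a \<otimes>\<^bsub>sym_group (sum_list l)\<^esub> b \<in> carrier (sym_group (sum_list l))"
        using that sub by blast
      moreover have "(a \<circ> b) ` row_entries l t i = row_entries l t i" for i
        using that unfolding column_permuting_group_def row_stabiliser_def mem_Collect_eq image_comp[symmetric]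
        by metis
      moreover have "\<exists>k. (a \<circ> b) ` column_entries l t j = column_entries l t k" for j
        using that unfolding column_permuting_group_def mem_Collect_eq image_comp[symmetric] by metis
      ultimately show ?thesis
        unfolding column_permuting_group_def row_stabiliser_def mem_Collect_eq sym_group_mult by blast
    qed
  qed
qed

text \<open>
  If $h^{-1}$ maps a column onto some column, then $g$ preserves the latter, and $h$ maps it back.
\<close>

lemma column_permuting_group_normalises:
  assumes h: "h \<in> column_permuting_group l t" and g: "g \<in> column_stabiliser l t"
  shows "h \<circ> g \<circ> inv' h \<in> column_stabiliser l t"
proof -
  let ?G = "sym_group (sum_list l)"
  have hG: "h \<in> carrier ?G" using h by (simp add: column_permuting_group_def row_stabiliser_def)
  then have perm: "h permutes {1..sum_list l}" by (simp add: sym_group_carrier)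
  have inv_h: "inv' h \<in> column_permuting_group l t"
    using subgroup.m_inv_closed[OF subgroup_column_permuting_group h] hG by simp
  have "(h \<circ> g \<circ> inv' h) ` column_entries l t j = column_entries l t j" for j
  proof -
    obtain k where k: "inv' h ` column_entries l t j = column_entries l t k"
      using inv_h unfolding column_permuting_group_def by blast
    have "(h \<circ> g \<circ> inv' h) ` column_entries l t j = h ` g ` column_entries l t k"
      by (simp only: image_comp[symmetric] k)
    also have "g ` column_entries l t k = inv' h ` column_entries l t j"
      using g k by (simp add: column_stabiliser_def)
    also have "h ` inv' h ` column_entries l t j = column_entries l t j"
      by (simp add: image_comp permutes_inv_o(1)[OF perm])
    finally show ?thesis .
  qed
  then show ?thesis
    using perm g by (simp add: column_stabiliser_def sym_group_carrier permutes_compose permutes_inv)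
qed

lemma polytabloid_apply:
  "(polytabloid l t :: tabloid \<Rightarrow> 'f::field) S =
    (\<Sum>g\<in>column_stabiliser l t. if S = tabloid_act g (tabloid_of l t) then of_int (sign g) else 0)"
proof -
  have "(\<Sum>g\<in>A. scl (permutation_module l) (c g) (tabloid_vec (f g))) S =
      (\<Sum>g\<in>A. if S = f g then c g else (0::'f))" for A :: "(nat \<Rightarrow> nat) set" and c f
    by (induction A rule: infinite_finite_induct) (auto simp: permutation_module_def tabloid_vec_def)
  then show ?thesis unfolding polytabloid_def .
qed

text \<open>
  Distinct elements of the column stabiliser give distinct tabloids, so only the identity contributes
  to this coefficient.
\<close>

lemma polytabloid_tabloid_coefficient:
  assumes t: "tableau l t"
  shows "(polytabloid l t :: tabloid \<Rightarrow> 'f::field) (tabloid_of l t) = 1"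
proof -
  have fin: "finite (column_stabiliser l t)"
    by (rule finite_subset[of _ "carrier (sym_group (sum_list l))"])
      (auto simp: column_stabiliser_def sym_group_def finite_permutations)
  have id: "id \<in> column_stabiliser l t"
    by (simp add: column_stabiliser_def sym_group_def permutes_id)
  have "(if tabloid_of l t = tabloid_act g (tabloid_of l t) then of_int (sign g) else 0) =
      (if g = id then 1 else (0::'f))" if "g \<in> column_stabiliser l t" for g
    using column_stabiliser_tabloid_act_eq_imp_id[OF t that]
    by (auto simp: tabloid_act_id sign_id)
  then have "(polytabloid l t :: tabloid \<Rightarrow> 'f) (tabloid_of l t) =
      (\<Sum>g\<in>column_stabiliser l t. if g = id then 1 else 0)"
    unfolding polytabloid_apply by (rule sum.cong[OF refl])
  also have "\<dots> = 1" using fin id by simp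
  finally show ?thesis .
qed

text \<open>
  Applying $h$ to the sum defining the polytabloid conjugates the column stabiliser by $h$. This
  only permutes the terms: the column stabiliser is normalised, signs are unchanged by conjugation,
  and the tabloid itself is fixed by $h$.
\<close>

lemma polytabloid_fixed:
  assumes t: "tableau l t" and h: "h \<in> column_permuting_group l t"
  shows "act (permutation_module l) h (polytabloid l t) = (polytabloid l t :: tabloid \<Rightarrow> 'f::field)"
proof
  fix S
  let ?T = "tabloid_of l t" and ?C = "column_stabiliser l t"
  let ?conj = "\<lambda>h g. h \<circ> g \<circ> inv' h"
  have hG: "h \<in> carrier (sym_group (sum_list l))" and hR: "h \<in> row_stabiliser l t"
    using h by (auto simp: column_permuting_group_def row_stabiliser_def)
  then have perm: "h permutes {1..sum_list l}" by (simp add: sym_group_carrier)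
  have inv_h: "inv' h \<in> column_permuting_group l t"
    using subgroup.m_inv_closed[OF subgroup_column_permuting_group h] hG by simp
  note o = permutes_inv_o[OF perm]
  have inv_inv: "inv' (inv' h) = h" using perm by (simp add: permutes_inv_inv)
  have comp_cancel: "h \<circ> (inv' h \<circ> f) = f" "inv' h \<circ> (h \<circ> f) = f" for f :: "nat \<Rightarrow> nat"
    using o by (simp_all flip: comp_assoc)
  have bij: "bij_betw (?conj h) ?C ?C"
    by (rule bij_betw_byWitness[where f' = "?conj (inv' h)"])
      (auto simp: comp_assoc comp_cancel o inv_inv
        intro: column_permuting_group_normalises[OF h, unfolded comp_assoc]
          column_permuting_group_normalises[OF inv_h, unfolded inv_inv comp_assoc])
  have act: "tabloid_act h (tabloid_act g ?T) = tabloid_act (?conj h g) ?T" for g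
  proof -
    have "tabloid_act (?conj h g) (tabloid_act h ?T) = tabloid_act h (tabloid_act g ?T)"
      by (simp add: tabloid_act_comp comp_assoc o)
    then show ?thesis using tabloid_act_row_stabiliser[OF t hR] by simp
  qed
  have sgn: "sign (?conj h g) = sign g" if "g \<in> ?C" for g
  proof -
    have "permutation h" "permutation g"
      using hG that by (auto simp: column_stabiliser_def intro: sym_group_carrier')
    then show ?thesis
      by (simp add: sign_compose sign_inverse permutation_compose permutation_inverse)
  qed
  have "act (permutation_module l) h (polytabloid l t) S =
      (polytabloid l t :: tabloid \<Rightarrow> 'f) (tabloid_act (inv' h) S)"
    by (simp add: permutation_module_def)
  also have "\<dots> = (\<Sum>g\<in>?C. if S = tabloid_act (?conj h g) ?T then of_int (sign (?conj h g)) else 0)"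
    unfolding polytabloid_apply
    by (intro sum.cong) (simp_all add: tabloid_act_inv_eq_iff[OF perm] act sgn)
  also have "\<dots> = (\<Sum>g\<in>?C. if S = tabloid_act g ?T then of_int (sign g) else 0)"
    by (rule sum.reindex_bij_betw[OF bij, where g = "\<lambda>g. if S = tabloid_act g ?T then of_int (sign g) else 0"])
  also have "\<dots> = (polytabloid l t :: tabloid \<Rightarrow> 'f) S"
    by (rule polytabloid_apply[symmetric])
  finally show "act (permutation_module l) h (polytabloid l t) S = (polytabloid l t :: tabloid \<Rightarrow> 'f) S" .
qed

section \<open>Vertices of Specht modules\<close>

theorem theorem1p1:
  fixes n p :: nat and l :: "nat list" and t :: "nat \<times> nat \<Rightarrow> nat"
  assumes "partition_of n l"
    and "tableau l t"
    and "prime p"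
    and "CHAR('f::field) = p"
    and "indecomposable (sym_group n) (specht_module l :: 'f tabloid_module)"
  shows "\<exists>Q P. is_vertex (sym_group n) (specht_module l :: 'f tabloid_module) Q \<and>
    sylow_subgroup p ((sym_group n)\<lparr>carrier := column_permuting_group l t\<rparr>) P \<and> P \<subseteq> Q"
proof -
  let ?G = "sym_group n" and ?H = "column_permuting_group l t"
  let ?S = "specht_module l :: 'f tabloid_module"
  note t = assms(2)
  have n: "sum_list l = n" using assms(1) by (simp add: partition_of_def)
  have fin: "finite (carrier ?G)" by (simp add: sym_group_def finite_permutations)
  interpret G: group ?G by (rule sym_group_is_group)
  have H: "subgroup ?H ?G" using subgroup_column_permuting_group[of l t] by (simp add: n)
  interpret H: group "?G\<lparr>carrier := ?H\<rparr>" using H by (rule G.subgroup_imp_group)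
  have "finite (carrier (?G\<lparr>carrier := ?H\<rparr>))"
    using fin finite_subset[OF subgroup.subset[OF H]] by simp
  then obtain P where P: "sylow_subgroup p (?G\<lparr>carrier := ?H\<rparr>) P"
    using H.sylow_subgroup_exists[OF _ assms(3)] by blast
  have P_sub: "subgroup P ?G"
    using G.incl_subgroup[OF H] P by (simp add: sylow_subgroup_def)
  have PH: "P \<subseteq> ?H" 
    using P subgroup.subset[of P "?G\<lparr>carrier := ?H\<rparr>"] by (simp add: sylow_subgroup_def)
  obtain k where k: "card P = CHAR('f) ^ k"
    using P assms(4) by (auto simp: sylow_subgroup_def)
  have p: "prime CHAR('f)" using assms(3,4) by simp
  interpret S: gmodule ?G ?S using assms(5) by (simp add: indecomposable_def)
  have "\<exists>Q. is_vertex ?G ?S Q \<and> P \<subseteq> Q"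
  proof (rule G.vertex_containing[OF fin assms(5) P_sub k p, where v = "polytabloid l t" and \<theta> = "\<lambda>w. w (tabloid_of l t)"])
    have "polytabloid l t \<in> S.span {polytabloid l s | s. tableau l s}"
      using t by (intro S.span_base) blast
    then show "polytabloid l t \<in> vecs ?S" by (simp add: specht_module_def)
    show "act ?S h (polytabloid l t) = polytabloid l t" if "h \<in> P" for h
      using polytabloid_fixed[OF t] that PH by (auto simp: specht_module_def)
    show "act ?S h w (tabloid_of l t) = w (tabloid_of l t)" if "h \<in> P" for h w
    proof -
      have "h \<in> row_stabiliser l t" and perm: "h permutes {1..n}"
        using that PH n by (auto simp: column_permuting_group_def row_stabiliser_def sym_group_carrier)
      then have "tabloid_of l t = tabloid_act h (tabloid_of l t)"
        by (simp add: tabloid_act_row_stabiliser[OF t])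
      then have "tabloid_act (inv' h) (tabloid_of l t) = tabloid_of l t"
        using tabloid_act_inv_eq_iff[OF perm] by blast
      then show ?thesis by (simp add: specht_module_def permutation_module_def)
    qed
    show "polytabloid l t (tabloid_of l t) \<noteq> (0::'f)"
      by (simp add: polytabloid_tabloid_coefficient[OF t])
  qed simp
  then show ?thesis using P by blast
qed

end
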